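(* Let $\theta>-1$, $\beta>-1$, $\gamma\in(0,1)$ and $M\in\mathbb{N}$. If $v\in C(\Lambda)\cap\mathcal{A}_{\theta,\beta,\gamma}^{1}(\Lambda)$ and $\mathscr{D}_{\beta,\gamma}v\in L^2_{\varrho^{\theta,\beta,\gamma}}(\Lambda)$, then $$\big\|\mathcal{I}_M^{\theta,\beta,\gamma}v\big\|_{\varrho^{\theta,\beta,\gamma}}\le C\Big[M^{-1/2}\big\|\mathscr{D}_{\beta,\gamma}v\big\|_{\varrho^{\theta,\beta,\gamma}}+2\sqrt{\log M}\,\|v\|_{\mathcal{A}_{\theta,\beta,\gamma}^{1}}\Big],$$ where $C>0$ is a constant independent of $M$ and $v$.
   Context: $\Lambda=(0,\infty)$. For $\theta>-1$, $\beta>-1$, $0<\gamma<1$ set $\varrho^{\theta,\beta,\gamma}(x):=(\beta+1)^{\theta+1}\gamma\,x^{\gamma(\theta+1)-1}e^{-(\beta+1)x^\gamma}$ for $x\in\Lambda$. For a weight $\varrho$, $L^2_\varrho(\Lambda)$ is the weighted space with norm $\|v\|_\varrho=(\int_0^\infty|v|^2\varrho\,dx)^{1/2}$. The mapped derivative is $\mathscr{D}_{\beta,\gamma}u(x):=\frac{x^{1-\gamma}}{(\beta+1)\gamma}\,\partial_xu(x)$. The space $\mathcal{A}_{\theta,\beta,\gamma}^{1}(\Lambda)$ consists of those $v\in L^2_{\varrho^{\theta,\beta,\gamma}}(\Lambda)$ with $\mathscr{D}_{\beta,\gamma}v\in L^2_{\varrho^{\theta+1,\beta,\gamma}}(\Lambda)$,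 with norm $\|v\|_{\mathcal{A}_{\theta,\beta,\gamma}^{1}}=\big(\|v\|_{\varrho^{\theta,\beta,\gamma}}^2+\|\mathscr{D}_{\beta,\gamma}v\|_{\varrho^{\theta+1,\beta,\gamma}}^2\big)^{1/2}$. $L_m^{(\theta)}(y)=\sum_{r=0}^m\frac{(-1)^r}{r!}\binom{m+\theta}{m-r}y^r$ is the generalized Laguerre polynomial of degree $m$. Let $y_0^{(\theta)},\dots,y_M^{(\theta)}\in(0,\infty)$ be the zeros of $L_{M+1}^{(\theta)}$ and $x_i^{(\theta,\beta,\gamma)}:=\big(y_i^{(\theta)}/(\beta+1)\big)^{1/\gamma}$, $0\le i\le M$. Let $\mathbb{P}_M^\gamma:=\operatorname{span}\{1,x^\gamma,\dots,x^{M\gamma}\}$. The interpolation operator $\mathcal{I}_M^{\theta,\beta,\gamma}:C(\Lambda)\to\mathbb{P}_M^\gamma$ is defined by $$\mathcal{I}_M^{\theta,\beta,\gamma}v(x)=\sum_{i=0}^Mv\big(x_i^{(\theta,\beta,\gamma)}\big)\prod_{\substack{r=0\\ r\ne i}}^M\frac{x^\gamma-(x_r^{(\theta,\beta,\gamma)})^\gamma}{(x_i^{(\theta,\beta,\gamma)})^\gamma-(x_r^{(\theta,\beta,\gamma)})^\gamma},$$ so that $\mathcal{I}_M^{\theta,\beta,\gamma}v(x_i^{(\theta,\beta,\gamma)})=v(x_i^{(\theta,\beta,\gamma)})$ for $0\le i\le M$.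
   Formalization: The bound is stated for M ≥ 2 only: at M = 0 the terms M^{-1/2} and log M are undefined, and at M = 1 the claim fails for v = 1, since log 1 = 0 and 𝒟v = 0 make the right side 0 while the interpolant 1 has positive norm. *)

theory Defs
  imports "HOL-Analysis.Analysis" "HOL-Computational_Algebra.Polynomial"
begin

abbreviation half_line :: "real set" where
  "half_line \<equiv> {0<..}"

definition weight :: "real \<Rightarrow> real \<Rightarrow> real \<Rightarrow> real \<Rightarrow> real" where
  "weight \<theta> \<beta> \<gamma> x =
     (\<beta> + 1) powr (\<theta> + 1) * \<gamma> * x powr (\<gamma> * (\<theta> + 1) - 1) * exp (- (\<beta> + 1) * x powr \<gamma>)"

text \<open>Elements of the weighted space are represented by functions on the whole line of which only
  the values on the half line matter. As the Bochner integral of a non-integrable function is 0,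
  \<open>L2_norm\<close> is meaningful only for members of \<open>L2\<close>. For the weights above this covers all
  polynomials in \<open>x powr \<gamma>\<close>, in particular the interpolants below.\<close>

definition L2 :: "(real \<Rightarrow> real) \<Rightarrow> (real \<Rightarrow> real) set" where
  "L2 \<rho> = {v. set_borel_measurable lebesgue half_line v \<and>
              set_integrable lebesgue half_line (\<lambda>x. \<bar>v x\<bar>\<^sup>2 * \<rho> x)}"

definition L2_norm :: "(real \<Rightarrow> real) \<Rightarrow> (real \<Rightarrow> real) \<Rightarrow> real" where
  "L2_norm \<rho> v = sqrt (LINT x:half_line|lebesgue. \<bar>v x\<bar>\<^sup>2 * \<rho> x)"

text \<open>Derivatives of elements of the weighted spaces are taken in the sense of distributions on the
  open half line.\<close>

definition test_function :: "(real \<Rightarrow> real) \<Rightarrow> bool" where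
  "test_function \<phi> \<longleftrightarrow>
     (\<forall>k x. (deriv ^^ k) \<phi> field_differentiable at x) \<and>
     (\<exists>K. compact K \<and> K \<subseteq> half_line \<and> (\<forall>x. x \<notin> K \<longrightarrow> \<phi> x = 0))"

definition locally_integrable :: "(real \<Rightarrow> real) \<Rightarrow> bool" where
  "locally_integrable f \<longleftrightarrow>
     (\<forall>K. compact K \<and> K \<subseteq> half_line \<longrightarrow> set_integrable lebesgue K f)"

definition has_weak_deriv :: "(real \<Rightarrow> real) \<Rightarrow> (real \<Rightarrow> real) \<Rightarrow> bool" where
  "has_weak_deriv u g \<longleftrightarrow>
     locally_integrable u \<and> locally_integrable g \<and>
     (\<forall>\<phi>. test_function \<phi> \<longrightarrow>
        (LINT x:half_line|lebesgue. u x * deriv \<phi> x) = - (LINT x:half_line|lebesgue. g x * \<phi> x))"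

text \<open>The weak derivative is unique up to null sets of the half line, so the choice of a
  representative affects neither membership in \<open>L2\<close> nor \<open>L2_norm\<close>.\<close>

definition weak_deriv :: "(real \<Rightarrow> real) \<Rightarrow> real \<Rightarrow> real" where
  "weak_deriv u = (SOME g. has_weak_deriv u g)"

definition mapped_deriv :: "real \<Rightarrow> real \<Rightarrow> (real \<Rightarrow> real) \<Rightarrow> real \<Rightarrow> real" where
  "mapped_deriv \<beta> \<gamma> u x = x powr (1 - \<gamma>) / ((\<beta> + 1) * \<gamma>) * weak_deriv u x"

definition A1 :: "real \<Rightarrow> real \<Rightarrow> real \<Rightarrow> (real \<Rightarrow> real) set" where
  "A1 \<theta> \<beta> \<gamma> = {v. v \<in> L2 (weight \<theta> \<beta> \<gamma>) \<and> (\<exists>g. has_weak_deriv v g) \<and>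
                  mapped_deriv \<beta> \<gamma> v \<in> L2 (weight (\<theta> + 1) \<beta> \<gamma>)}"

definition A1_norm :: "real \<Rightarrow> real \<Rightarrow> real \<Rightarrow> (real \<Rightarrow> real) \<Rightarrow> real" where
  "A1_norm \<theta> \<beta> \<gamma> v =
     sqrt ((L2_norm (weight \<theta> \<beta> \<gamma>) v)\<^sup>2 +
           (L2_norm (weight (\<theta> + 1) \<beta> \<gamma>) (mapped_deriv \<beta> \<gamma> v))\<^sup>2)"

definition laguerre :: "real \<Rightarrow> nat \<Rightarrow> real poly" where
  "laguerre \<theta> m =
     (\<Sum>r\<le>m. monom ((-1) ^ r / fact r * ((real m + \<theta>) gchoose (m - r))) r)"

text \<open>The zeros of the Laguerre polynomial of degree \<open>M + 1\<close> in increasing order; for \<open>\<theta> > -1\<close>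
  there are exactly \<open>M + 1\<close> of them, so the index \<open>i\<close> ranges over \<open>{..M}\<close>.\<close>

definition laguerre_zero :: "real \<Rightarrow> nat \<Rightarrow> nat \<Rightarrow> real" where
  "laguerre_zero \<theta> M i = sorted_list_of_set {y. 0 < y \<and> poly (laguerre \<theta> (M + 1)) y = 0} ! i"

definition node :: "real \<Rightarrow> real \<Rightarrow> real \<Rightarrow> nat \<Rightarrow> nat \<Rightarrow> real" where
  "node \<theta> \<beta> \<gamma> M i = (laguerre_zero \<theta> M i / (\<beta> + 1)) powr (1 / \<gamma>)"

definition interpolant ::
    "real \<Rightarrow> real \<Rightarrow> real \<Rightarrow> nat \<Rightarrow> (real \<Rightarrow> real) \<Rightarrow> real \<Rightarrow> real" where
  "interpolant \<theta> \<beta> \<gamma> M v x =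
     (\<Sum>i\<le>M. v (node \<theta> \<beta> \<gamma> M i) *
        (\<Prod>r\<in>{..M} - {i}. (x powr \<gamma> - node \<theta> \<beta> \<gamma> M r powr \<gamma>) /
                          (node \<theta> \<beta> \<gamma> M i powr \<gamma> - node \<theta> \<beta> \<gamma> M r powr \<gamma>)))"

end

(*
  The substitution y = (beta+1) x^gamma turns the weight into y^theta e^{-y} dy and the interpolant
  into Lagrange interpolation at the zeros of the Laguerre polynomial, so by Gauss quadrature the
  squared norm of the interpolant is the sum of lambda_a v(a)^2 over the zeros a. A Sobolev type
  estimate bounds v(a)^2 by a constant times a^{-theta-1} e^a times the squared A^1-norm, so that
  everything reduces to sum_a lambda_a a^{-theta-1} e^a = O(log M).

  No asymptotics of the zeros or of the Christoffel numbers lambda_a are needed. If the even order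
  derivatives of f are nonnegative, the Gauss sum of f is at most its integral. On [2^{-J}, 2^J] the
  function y^{-theta-1} e^y is dominated by a sum of O(J) such functions, namely suitable multiples
  of exp((1 - 2^{-j}) y) and (1 + 2^j y)^{-m}, each of which has an integral bounded independently
  of j. Vieta's formulas for the sums of the zeros and of their reciprocals show that J = O(log M)
  suffices.
*)
theory Submission
  imports Defs
begin

section \<open>Integrals against the Laguerre weight\<close>

text \<open>The function y^{-\<theta>-1} e^y times the weight y^\<theta> e^{-y} is 1/y, whose
  integral diverges logarithmically both at 0 and at infinity. This is where log M comes from, and
  why a cutoff at scales polynomial in M is needed before sums can be compared with integrals. At
  scale 2^j the function exp((1 - 2^{-j}) y) is comparable to e^y for y up to about 2^j and has mass
  of order 2^{j(\<theta>+1)}; the function (1 + 2^j y)^{-m} is comparable to 1 for y up to about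
  2^{-j} and, once m > \<theta>+1, has mass at most of order 2^{-j(\<theta>+1)}. The multiples
  2^{-j(\<theta>+1)} and 2^{j(\<theta>+1)} cancel these masses. The sign condition on derivatives
  enters through divided differences alone (\<open>dd_cone\<close>), so no remainder formula with
  higher derivatives occurs. The other obstacle is that v is differentiable only in the sense of
  distributions: before its values can be estimated, the fundamental theorem of calculus has to be
  recovered for continuous v, and this takes explicit smooth test functions.\<close>

lemma half_line_cong:
  fixes f g :: "real \<Rightarrow> real"
  assumes "\<And>y. y > 0 \<Longrightarrow> f y = g y"
  shows "f absolutely_integrable_on half_line \<longleftrightarrow> g absolutely_integrable_on half_line"
    and "integral half_line f = integral half_line g"
  using assms by (intro set_integrable_cong Henstock_Kurzweil_Integration.integral_cong; simp)+

text \<open>Euler's integral after the substitution y -> c y. The integrand is nonnegative, so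
  integrability is absolute. The case c = 1 gives the moments, c = 1 - a the integrals of exp(a
  y).\<close>

lemma absolutely_integrable_Gamma_weight:
  fixes s c :: real
  assumes "s > 0" "c > 0"
  shows "(\<lambda>y. y powr (s - 1) * exp (- (c * y))) absolutely_integrable_on {0<..}" (is ?A)
    and "integral {0<..} (\<lambda>y. y powr (s - 1) * exp (- (c * y))) = Gamma s / c powr s" (is ?B)
proof -
  let ?f = "\<lambda>y::real. y powr (s - 1) * exp (- y)"
  have "(?f has_integral Gamma s) {0..}"
    using Gamma_integral_real[OF assms(1)] by (simp add: exp_minus divide_inverse)
  hence *: "(?f has_integral Gamma s) {0<..}"
    by (subst (asm) has_integral_spike_set_eq[where T = "{0<..}"])
      (auto intro: negligible_subset[of "{0}"])
  hence "?f absolutely_integrable_on {0<..} \<and> integral {0<..} ?f = Gamma s"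
    by (auto simp: has_integral_iff intro!: nonnegative_absolutely_integrable_1)
  moreover have "(*) c ` {0<..} = {0<..}"
  proof safe
    fix y :: real assume "y > 0"
    thus "y \<in> (*) c ` {0<..}" using assms by (intro image_eqI[of _ _ "y / c"]) auto
  qed (use assms in auto)
  ultimately have "(\<lambda>y. \<bar>c\<bar> * ?f (c * y)) absolutely_integrable_on {0<..} \<and>
      integral {0<..} (\<lambda>y. \<bar>c\<bar> * ?f (c * y)) = Gamma s"
    using assms(2)
    by (subst has_absolute_integral_change_of_variables_1'[where g = "(*) c"])
      (auto intro!: derivative_eq_intros simp: inj_on_def)
  moreover have "\<bar>c\<bar> * ?f (c * y) = c powr s * (y powr (s - 1) * exp (- (c * y)))" if "y > 0" for y
    using assms that by (simp add: powr_mult powr_diff)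
  note half_line_cong[OF this]
  ultimately have 1: "(\<lambda>y. c powr s * (y powr (s - 1) * exp (- (c * y)))) absolutely_integrable_on {0<..}"
    and 2: "integral {0<..} (\<lambda>y. c powr s * (y powr (s - 1) * exp (- (c * y)))) = Gamma s"
    by auto
  show ?A using set_integrable_mult_right[OF 1, of "1 / c powr s"] assms
    by (simp add: field_simps)
  show ?B using 2 assms by (simp add: field_simps)
qed

definition lag_integral :: "real \<Rightarrow> (real \<Rightarrow> real) \<Rightarrow> real" where
  "lag_integral \<theta> f = integral {0<..} (\<lambda>y. f y * (y powr \<theta> * exp (- y)))"

text \<open>Absolute integrability, because it passes to subintervals and to products with bounded
  measurable functions.\<close>

definition lag_integrable :: "real \<Rightarrow> (real \<Rightarrow> real) \<Rightarrow> bool" where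
  "lag_integrable \<theta> f \<longleftrightarrow> (\<lambda>y. f y * (y powr \<theta> * exp (- y))) absolutely_integrable_on {0<..}"

lemma lag_integrable_add:
  assumes "lag_integrable \<theta> f" "lag_integrable \<theta> g"
  shows "lag_integrable \<theta> (\<lambda>y. f y + g y)"
    and "lag_integral \<theta> (\<lambda>y. f y + g y) = lag_integral \<theta> f + lag_integral \<theta> g"
  using assms unfolding lag_integrable_def lag_integral_def
  by (auto simp: distrib_right set_lebesgue_integral_eq_integral
      intro!: Henstock_Kurzweil_Integration.integral_add)

lemma lag_integrable_cmult:
  assumes "lag_integrable \<theta> f"
  shows "lag_integrable \<theta> (\<lambda>y. c * f y)"
    and "lag_integral \<theta> (\<lambda>y. c * f y) = c * lag_integral \<theta> f"
  using assms unfolding lag_integrable_def lag_integral_def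
  by (auto simp: mult.assoc)

lemma lag_integrable_sum:
  assumes "\<And>i. i \<in> I \<Longrightarrow> lag_integrable \<theta> (f i)"
  shows "lag_integrable \<theta> (\<lambda>y. \<Sum>i\<in>I. f i y)"
    and "lag_integral \<theta> (\<lambda>y. \<Sum>i\<in>I. f i y) = (\<Sum>i\<in>I. lag_integral \<theta> (f i))"
proof -
  have "lag_integrable \<theta> (\<lambda>y. \<Sum>i\<in>I. f i y) \<and>
      lag_integral \<theta> (\<lambda>y. \<Sum>i\<in>I. f i y) = (\<Sum>i\<in>I. lag_integral \<theta> (f i))"
    using assms
  proof (induction I rule: infinite_finite_induct)
    case (insert x F)
    thus ?case using lag_integrable_add[of \<theta> "f x" "\<lambda>y. \<Sum>i\<in>F. f i y"] by simp
  qed (simp_all add: lag_integrable_def lag_integral_def)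
  thus "lag_integrable \<theta> (\<lambda>y. \<Sum>i\<in>I. f i y)"
    and "lag_integral \<theta> (\<lambda>y. \<Sum>i\<in>I. f i y) = (\<Sum>i\<in>I. lag_integral \<theta> (f i))" by auto
qed

lemma lag_integral_mono:
  assumes "lag_integrable \<theta> f" "lag_integrable \<theta> g" "\<And>y. y > 0 \<Longrightarrow> f y \<le> g y"
  shows "lag_integral \<theta> f \<le> lag_integral \<theta> g"
  using assms unfolding lag_integrable_def lag_integral_def
  by (intro integral_le) (auto simp: set_lebesgue_integral_eq_integral mult_right_mono)

lemma lag_integrable_exp_power:
  assumes "\<theta> > -1" "a < 1"
  shows "lag_integrable \<theta> (\<lambda>y. exp (a * y))"
    and "lag_integral \<theta> (\<lambda>y. exp (a * y)) = Gamma (\<theta> + 1) / (1 - a) powr (\<theta> + 1)"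
proof -
  have eq: "exp (a * y) * (y powr \<theta> * exp (- y)) = y powr (\<theta> + 1 - 1) * exp (- ((1 - a) * y))" for y
    by (simp add: exp_add[symmetric] algebra_simps exp_minus exp_diff divide_inverse)
  show "lag_integrable \<theta> (\<lambda>y. exp (a * y))"
    "lag_integral \<theta> (\<lambda>y. exp (a * y)) = Gamma (\<theta> + 1) / (1 - a) powr (\<theta> + 1)"
    using absolutely_integrable_Gamma_weight[of "\<theta> + 1" "1 - a"] assms
    unfolding lag_integrable_def lag_integral_def eq by auto
qed

lemma lag_integrable_power:
  assumes "\<theta> > -1"
  shows "lag_integrable \<theta> (\<lambda>y. y ^ k)"
    and "lag_integral \<theta> (\<lambda>y. y ^ k) = Gamma (\<theta> + 1 + real k)"
proof -
  have eq: "y ^ k * (y powr \<theta> * exp (- y)) = y powr (\<theta> + 1 + k - 1) * exp (- (1 * y))"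
    if "y > 0" for y
    using that by (simp add: powr_add powr_realpow)
  show "lag_integrable \<theta> (\<lambda>y. y ^ k)"
    "lag_integral \<theta> (\<lambda>y. y ^ k) = Gamma (\<theta> + 1 + real k)"
    using absolutely_integrable_Gamma_weight[of "\<theta> + 1 + k" 1] assms
    half_line_cong[OF eq]
    unfolding lag_integrable_def lag_integral_def by auto
qed

text \<open>The bound \<open>n\<close> may exceed the degree, so a degree estimate suffices for the
  expansion into moments.\<close>

lemma lag_integrable_poly:
  assumes "\<theta> > -1"
  shows "lag_integrable \<theta> (poly p)"
    and "degree p \<le> n \<Longrightarrow> lag_integral \<theta> (poly p) = (\<Sum>k\<le>n. coeff p k * Gamma (\<theta> + 1 + real k))"
proof -
  have 1: "poly p = (\<lambda>y. \<Sum>k\<le>n. coeff p k * y ^ k)" if "degree p \<le> n" for n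
    using that by (auto simp: poly_altdef fun_eq_iff intro!: le_degree intro!: sum.mono_neutral_left)
  have 2: "lag_integrable \<theta> (\<lambda>y. coeff p k * y ^ k)"
    "lag_integral \<theta> (\<lambda>y. coeff p k * y ^ k) = coeff p k * Gamma (\<theta> + 1 + real k)" for k
    using lag_integrable_cmult[OF lag_integrable_power(1)[OF assms]] lag_integrable_power(2)[OF assms]
    by auto
  show "lag_integrable \<theta> (poly p)"
    by (subst 1[OF order.refl]) (intro lag_integrable_sum 2)
  show "lag_integral \<theta> (poly p) = (\<Sum>k\<le>n. coeff p k * Gamma (\<theta> + 1 + real k))" if "degree p \<le> n"
    by (subst 1[OF that], subst lag_integrable_sum) (auto simp: 2)
qed

text \<open>If the integral were 0, the continuous nonnegative integrand would vanish on all of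
  [1, 2], giving \<open>p\<close> infinitely many roots.\<close>

lemma lag_integral_poly_pos:
  assumes "\<theta> > -1" "p \<noteq> 0" "\<And>y. y > 0 \<Longrightarrow> poly p y \<ge> 0"
  shows "lag_integral \<theta> (poly p) > 0"
proof -
  let ?f = "\<lambda>y. poly p y * (y powr \<theta> * exp (- y))"
  have int: "?f absolutely_integrable_on {0<..}"
    using lag_integrable_poly(1)[OF assms(1)] by (simp add: lag_integrable_def)
  have "integral {0<..} ?f \<ge> 0"
    by (rule Henstock_Kurzweil_Integration.integral_nonneg)
      (use int assms(3) in \<open>auto simp: set_lebesgue_integral_eq_integral\<close>)
  moreover have "integral {0<..} ?f \<noteq> 0"
  proof
    assume "integral {0<..} ?f = 0"
    hence "(?f has_integral 0) {0<..}"
      using int by (simp add: has_integral_iff set_lebesgue_integral_eq_integral)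
    moreover have sub: "?f absolutely_integrable_on {1..2}"
      by (rule set_integrable_subset[OF int]) auto
    moreover have "integral {1..2} ?f \<le> integral {0<..} ?f"
      by (rule integral_subset_le)
        (use int sub assms(3) in \<open>auto simp: set_lebesgue_integral_eq_integral\<close>)
    moreover have "integral {1..2} ?f \<ge> 0"
      by (rule Henstock_Kurzweil_Integration.integral_nonneg)
        (use sub assms(3) in \<open>auto simp: set_lebesgue_integral_eq_integral\<close>)
    ultimately have "(?f has_integral 0) (cbox 1 2)"
      using \<open>integral {0<..} ?f = 0\<close> by (simp add: has_integral_iff set_lebesgue_integral_eq_integral)
    hence "?f y = 0" if "y \<in> cbox 1 2" for y
      by (intro has_integral_0_cbox_imp_0[of 1 2 ?f]) (use that assms(3) in \<open>auto intro!: continuous_intros\<close>)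
    hence "{1..2} \<subseteq> {y. poly p y = 0}" by auto
    moreover have "finite {y. poly p y = 0}" using assms(2) by (rule poly_roots_finite)
    ultimately show False using finite_subset infinite_Icc[of "1::real" 2] by (metis one_less_numeral_iff semiring_norm(76))
  qed
  ultimately show ?thesis unfolding lag_integral_def by linarith
qed

section \<open>Zeros of Laguerre polynomials and Gauss quadrature\<close>

lemma coeff_laguerre:
  "coeff (laguerre \<theta> m) r = (if r \<le> m then (-1) ^ r / fact r * ((real m + \<theta>) gchoose (m - r)) else 0)"
  unfolding laguerre_def coeff_sum coeff_monom
  by (subst sum.delta) (auto simp: eq_commute)

lemma degree_laguerre [simp]: "degree (laguerre \<theta> m) = m"
  by (rule antisym) (auto intro!: degree_le le_degree simp: coeff_laguerre)

text \<open>One step of Rodrigues' formula: the derivative of y^{\<theta>+1} e^{-y}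
  L_n^{(\<theta>+1)} is (n+1) y^\<theta> e^{-y} L_{n+1}^{(\<theta>)}, with the common factor
  y^\<theta> e^{-y} removed.\<close>

lemma laguerre_recurrence:
  "pCons 0 (pderiv (laguerre (\<theta> + 1) n)) + smult (\<theta> + 1) (laguerre (\<theta> + 1) n)
     - pCons 0 (laguerre (\<theta> + 1) n) = smult (real (Suc n)) (laguerre \<theta> (Suc n))"
proof (rule poly_eqI)
  fix r
  let ?a = "real n + (\<theta> + 1)"
  have a: "real (Suc n) + \<theta> = ?a" by simp
  have step: "(?a - real k) * (?a gchoose k) = real (Suc k) * (?a gchoose Suc k)" for k
    using gbinomial_mult_1[of ?a k] by (simp add: algebra_simps)
  consider "r = 0" | r' where "r = Suc r'" "r' < n" | r' where "r = Suc r'" "r' = n" | r' where "r = Suc r'" "r' > n"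
    by (metis not0_implies_Suc linorder_neqE_nat)
  thus "coeff (pCons 0 (pderiv (laguerre (\<theta> + 1) n)) + smult (\<theta> + 1) (laguerre (\<theta> + 1) n)
     - pCons 0 (laguerre (\<theta> + 1) n)) r = coeff (smult (real (Suc n)) (laguerre \<theta> (Suc n))) r"
  proof cases
    case 1
    thus ?thesis using step[of n] by (simp add: coeff_laguerre a del: of_nat_Suc)
  next
    case (2 r')
    \<comment> \<open>With k = n - r the coefficient of \<open>laguerre (\<theta> + 1) n\<close> at
      r has lower binomial index k, the two other coefficients have k + 1, and \<open>step\<close>
      relates the two.\<close>
    define k where "k = n - Suc r'"
    have k: "n - r' = Suc k" "n - Suc r' = k" "Suc n - r = Suc k" "real n = real k + real r' + 1"
      using 2 by (auto simp: k_def)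
    define F R :: real where "F = (-1) ^ r' / fact r'" and "R = real r' + 1"
    have R: "R > 0" by (simp add: R_def)
    have FR: "(-1) ^ Suc r' / fact (Suc r') = - (F / R)"
      by (simp add: F_def R_def field_simps)
    have c: "coeff (laguerre (\<theta> + 1) n) r = - (F / R) * (?a gchoose k)"
      "coeff (laguerre (\<theta> + 1) n) r' = F * (?a gchoose Suc k)"
      "coeff (laguerre \<theta> (Suc n)) r = - (F / R) * (?a gchoose Suc k)"
      using 2(2) k(1,2,3) unfolding coeff_laguerre a FR[symmetric] F_def 2(1) by (simp_all add: R_def)
    have "(R + \<theta> + 1) * (?a gchoose k) = (real k + 1) * (?a gchoose Suc k)"
      using step[of k] k(4) by (simp add: R_def algebra_simps)
    hence "(R + \<theta> + 1) * (- (F / R) * (?a gchoose k)) - F * (?a gchoose Suc k)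
        = (real k + R + 1) * (- (F / R) * (?a gchoose Suc k))"
      using R by (simp add: field_simps)
    moreover have "real (Suc n) = real k + R + 1" using k(4) by (simp add: R_def)
    moreover have "coeff (pCons 0 (pderiv (laguerre (\<theta> + 1) n))) r = R * coeff (laguerre (\<theta> + 1) n) r"
      using 2 by (simp add: coeff_pderiv R_def)
    moreover have "coeff (pCons 0 (laguerre (\<theta> + 1) n)) r = coeff (laguerre (\<theta> + 1) n) r'"
      using 2 by simp
    moreover have "R * x + (\<theta> + 1) * x = (R + \<theta> + 1) * x" for x by algebra
    ultimately show ?thesis unfolding coeff_add coeff_diff coeff_smult c(3)
      by (simp only: c(1,2))
  next
    case (3 r')
    thus ?thesis by (simp add: coeff_laguerre coeff_pderiv a)
  next
    case (4 r')
    thus ?thesis by (simp add: coeff_laguerre coeff_pderiv)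
  qed
qed

lemma lag_integral_pCons:
  assumes "\<theta> > -1"
  shows "lag_integral \<theta> (poly (pCons 0 p)) = lag_integral (\<theta> + 1) (poly p)"
  unfolding lag_integral_def
  by (rule half_line_cong) (simp add: powr_add)

lemma lag_integral_poly_add:
  assumes "\<theta> > -1"
  shows "lag_integral \<theta> (poly (p + q)) = lag_integral \<theta> (poly p) + lag_integral \<theta> (poly q)"
  using lag_integrable_add(2)[OF lag_integrable_poly(1)[OF assms] lag_integrable_poly(1)[OF assms]]
  by (simp add: poly_add[abs_def])

lemma lag_integral_poly_smult:
  assumes "\<theta> > -1"
  shows "lag_integral \<theta> (poly (smult c p)) = c * lag_integral \<theta> (poly p)"
  using lag_integrable_cmult(2)[OF lag_integrable_poly(1)[OF assms]]
  by (simp add: poly_smult[abs_def])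

lemma lag_integral_poly_diff:
  assumes "\<theta> > -1"
  shows "lag_integral \<theta> (poly (p - q)) = lag_integral \<theta> (poly p) - lag_integral \<theta> (poly q)"
  using lag_integral_poly_add[OF assms, of p "smult (-1) q"] lag_integral_poly_smult[OF assms, of "-1" q]
  by simp

lemma lag_integral_poly_0: "lag_integral \<theta> (poly 0) = 0"
  by (simp add: lag_integral_def)

text \<open>The integrand is the derivative of \<open>y powr (\<theta> + 1) * exp (- y) * poly p y\<close>.\<close>
lemma lag_integral_pderiv:
  assumes "\<theta> > -1"
  shows "lag_integral \<theta> (poly (pCons 0 (pderiv p) + smult (\<theta> + 1) p - pCons 0 p)) = 0"
proof -
  define n where "n = degree p"
  have "degree (pCons 0 (pderiv p) + smult (\<theta> + 1) p - pCons 0 p) \<le> Suc n"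
    by (intro degree_diff_le degree_add_le degree_pCons_le[THEN order_trans])
      (auto simp: n_def degree_pderiv intro: degree_smult_le[THEN order_trans])
  hence "lag_integral \<theta> (poly (pCons 0 (pderiv p) + smult (\<theta> + 1) p - pCons 0 p)) =
     (\<Sum>k\<le>Suc n. coeff (pCons 0 (pderiv p) + smult (\<theta> + 1) p - pCons 0 p) k * Gamma (\<theta> + 1 + real k))"
    by (rule lag_integrable_poly(2)[OF assms])
  also have "\<dots> = (\<Sum>k\<le>Suc n. (\<theta> + 1 + real k) * coeff p k * Gamma (\<theta> + 1 + real k))
      - (\<Sum>k\<le>Suc n. coeff (pCons 0 p) k * Gamma (\<theta> + 1 + real k))"
    unfolding sum_subtractf[symmetric]
    by (intro sum.cong refl) (simp add: coeff_pCons coeff_pderiv algebra_simps split: nat.splits)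
  also have "(\<Sum>k\<le>Suc n. coeff (pCons 0 p) k * Gamma (\<theta> + 1 + real k)) =
      (\<Sum>k\<le>n. coeff p k * Gamma (\<theta> + 1 + real (Suc k)))"
    by (subst sum.atMost_Suc_shift) simp
  also have "(\<Sum>k\<le>Suc n. (\<theta> + 1 + real k) * coeff p k * Gamma (\<theta> + 1 + real k)) =
      (\<Sum>k\<le>n. coeff p k * Gamma (\<theta> + 1 + real (Suc k)))"
  proof -
    \<comment> \<open>The functional equation of \<open>Gamma\<close> takes the place of boundary
      terms at 0 and infinity: it makes the two moment sums agree.\<close>
    have "Gamma (\<theta> + 1 + real (Suc k)) = (\<theta> + 1 + real k) * Gamma (\<theta> + 1 + real k)" for k
    proof -
      have "\<theta> + 1 + real k > 0" using assms by linarith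
      hence "\<theta> + 1 + real k \<notin> \<int>\<^sub>\<le>\<^sub>0" by (meson nonpos_Ints_nonpos not_le)
      from Gamma_plus1[OF this] show ?thesis by (simp add: add_ac)
    qed
    moreover have "coeff p (Suc n) = 0" by (simp add: n_def coeff_eq_0)
    ultimately show ?thesis by (simp add: mult_ac)
  qed
  finally show ?thesis by (simp only: diff_self)
qed

text \<open>Integration by parts moves one derivative onto \<open>q\<close>. The remaining factor y
  raises \<theta> by 1 while n drops by 1, hence the induction with \<theta> arbitrary.\<close>

lemma laguerre_orthogonal:
  assumes "\<theta> > -1" "degree q < n"
  shows "lag_integral \<theta> (poly (q * laguerre \<theta> n)) = 0"
  using assms
proof (induction n arbitrary: q \<theta>)
  case (Suc n)
  define L where "L = laguerre (\<theta> + 1) n"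
  have "smult (real (Suc n)) (q * laguerre \<theta> (Suc n)) =
      q * (pCons 0 (pderiv L) + smult (\<theta> + 1) L - pCons 0 L)"
    unfolding L_def laguerre_recurrence by simp
  also have "\<dots> = (pCons 0 (pderiv (q * L)) + smult (\<theta> + 1) (q * L) - pCons 0 (q * L))
      - pCons 0 (pderiv q * L)"
    by (simp add: pderiv_mult algebra_simps)
  finally have "real (Suc n) * lag_integral \<theta> (poly (q * laguerre \<theta> (Suc n))) =
      - lag_integral \<theta> (poly (pCons 0 (pderiv q * L)))"
    using Suc.prems(1)
    by (metis lag_integral_poly_smult lag_integral_poly_diff lag_integral_pderiv diff_0)
  also have "lag_integral \<theta> (poly (pCons 0 (pderiv q * L))) = lag_integral (\<theta> + 1) (poly (pderiv q * L))"
    by (rule lag_integral_pCons) fact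
  also have "\<dots> = 0"
  \<comment> \<open>The induction hypothesis needs \<open>degree (pderiv q) < n\<close>, which fails
    for constant \<open>q\<close> when n = 0; then \<open>pderiv q\<close> vanishes anyway.\<close>
  proof (cases "degree q = 0")
    case True
    hence "pderiv q = 0" by (simp add: pderiv_eq_0_iff)
    thus ?thesis by (simp add: lag_integral_poly_0 del: poly_0)
  next
    case False
    thus ?thesis unfolding L_def using Suc.prems by (intro Suc.IH) (auto simp: degree_pderiv)
  qed
  finally show ?case by simp
qed simp

section \<open>Nodal polynomials and the simplicity of the zeros\<close>

definition nodal :: "real set \<Rightarrow> real poly" where
  "nodal A = (\<Prod>a\<in>A. [:-a, 1:])"

lemma nodal_insert: "finite A \<Longrightarrow> a \<notin> A \<Longrightarrow> nodal (insert a A) = [:-a, 1:] * nodal A"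
  by (simp add: nodal_def)

lemma nodal_remove: "finite A \<Longrightarrow> a \<in> A \<Longrightarrow> nodal A = [:-a, 1:] * nodal (A - {a})"
  by (simp add: nodal_def prod.remove)

lemma degree_nodal: "degree (nodal A) = card A"
  unfolding nodal_def by (subst degree_prod_sum_eq) auto

lemma lead_coeff_nodal: "lead_coeff (nodal A) = 1"
  by (simp add: nodal_def lead_coeff_prod)

lemma nodal_nonzero: "nodal A \<noteq> 0"
  using lead_coeff_nodal[of A] by auto

lemma poly_nodal: "poly (nodal A) y = (\<Prod>a\<in>A. y - a)"
  by (simp add: nodal_def poly_prod)

lemma poly_nodal_0_iff: "finite A \<Longrightarrow> poly (nodal A) y = 0 \<longleftrightarrow> y \<in> A"
  by (auto simp: poly_nodal)

lemma nodal_dvd: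
  assumes "finite A" "\<And>a. a \<in> A \<Longrightarrow> poly p a = 0"
  shows "nodal A dvd p"
  using assms
proof (induction A)
  case (insert a A)
  then obtain q where q: "p = nodal A * q" by (auto elim: dvdE)
  have "poly p a = 0" "poly (nodal A) a \<noteq> 0" using insert by (auto simp: poly_nodal_0_iff)
  hence "poly q a = 0" by (simp add: q)
  hence "[:-a, 1:] dvd q" by (simp add: poly_eq_0_iff_dvd)
  hence "[:-a, 1:] * nodal A dvd q * nodal A" by (rule mult_dvd_mono) simp
  thus ?case unfolding q nodal_insert[OF insert.hyps] by (simp only: mult.commute)
qed (simp add: nodal_def)

text \<open>Positive roots are split off one at a time. A root met again leaves \<open>A\<close> and
  enters \<open>s\<close> as a square, so \<open>A\<close> ends up as the positive roots of odd
  multiplicity, the points where \<open>p\<close> changes sign.\<close>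

lemma poly_const_sign_factor:
  assumes "(p :: real poly) \<noteq> 0"
  shows "\<exists>A s. finite A \<and> A \<subseteq> {0<..} \<and> p = nodal A * s \<and>
    ((\<forall>y>0. poly s y \<ge> 0) \<or> (\<forall>y>0. poly s y \<le> 0))"
  using assms
proof (induction "degree p" arbitrary: p rule: less_induct)
  case (less p)
  show ?case
  proof (cases "\<exists>a>0. poly p a = 0")
    case False
    have "(\<forall>y>0. poly p y \<ge> 0) \<or> (\<forall>y>0. poly p y \<le> 0)"
    proof (rule ccontr)
      assume "\<not> ?thesis"
      then obtain y z where yz: "y > 0" "z > 0" "poly p y < 0" "poly p z > 0"
        by (auto simp: not_le)
      have "y \<noteq> z" using yz by auto
      then consider "y < z" | "z < y" by linarith
      thus False
      proof cases
        case 1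
        from poly_IVT_pos[OF this yz(3,4)] yz False show False by force
      next
        case 2
        from poly_IVT_neg[OF this yz(4,3)] yz False show False by force
      qed
    qed
    thus ?thesis by (intro exI[of _ "{}"] exI[of _ p]) (auto simp: nodal_def)
  next
    case True
    then obtain a q where a: "a > 0" "p = [:-a, 1:] * q" by (auto simp: poly_eq_0_iff_dvd elim!: dvdE)
    have "q \<noteq> 0" using less.prems a by auto
    moreover from this have "degree p = Suc (degree q)"
      unfolding a(2) by (subst degree_mult_eq) auto
    ultimately obtain A s where As: "finite A" "A \<subseteq> {0<..}" "q = nodal A * s"
      "(\<forall>y>0. poly s y \<ge> 0) \<or> (\<forall>y>0. poly s y \<le> 0)"
      using less.hyps[of q] by auto
    show ?thesis
    proof (cases "a \<in> A")
      case False
      have "p = nodal (insert a A) * s"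
        unfolding a(2) As(3) nodal_insert[OF As(1) False] by (simp only: mult.assoc)
      moreover have "insert a A \<subseteq> {0<..}" "finite (insert a A)" using a As by auto
      ultimately show ?thesis using As(4) by blast
    next
      case True
      have "p = nodal (A - {a}) * ([:-a, 1:] ^ 2 * s)"
        unfolding a(2) As(3) nodal_remove[OF As(1) True] power2_eq_square by (simp only: mult_ac)
      moreover have "(\<forall>y>0. poly ([:-a, 1:] ^ 2 * s) y \<ge> 0) \<or> (\<forall>y>0. poly ([:-a, 1:] ^ 2 * s) y \<le> 0)"
        using As(4) by (auto simp: mult_nonneg_nonneg mult_nonneg_nonpos)
      ultimately show ?thesis using As(1,2) by blast
    qed
  qed
qed

text \<open>The unordered form of the zeros: \<open>laguerre_zero \<theta> M\<close> enumerates
  \<open>laguerre_roots \<theta> (M + 1)\<close>.\<close>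

definition laguerre_roots :: "real \<Rightarrow> nat \<Rightarrow> real set" where
  "laguerre_roots \<theta> n = {y. 0 < y \<and> poly (laguerre \<theta> n) y = 0}"

lemma laguerre_root_pos: "a \<in> laguerre_roots \<theta> n \<Longrightarrow> a > 0"
  by (simp add: laguerre_roots_def)

lemma laguerre_nonzero: "laguerre \<theta> n \<noteq> 0"
proof
  assume "laguerre \<theta> n = 0"
  hence "coeff (laguerre \<theta> n) n = 0" by simp
  thus False by (simp add: coeff_laguerre)
qed

text \<open>With fewer than n sign changes, the nodal polynomial of the sign changes would be
  orthogonal to \<open>laguerre \<theta> n\<close>; yet their product is a square times a factor of
  constant sign and has nonzero integral. So there are n sign changes, and the cofactor is a
  constant.\<close>

lemma laguerre_roots:
  assumes "\<theta> > -1"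
  shows finite_laguerre_roots: "finite (laguerre_roots \<theta> n)"
    and card_laguerre_roots: "card (laguerre_roots \<theta> n) = n"
    and laguerre_eq_nodal: "laguerre \<theta> n = smult ((-1) ^ n / fact n) (nodal (laguerre_roots \<theta> n))"
proof -
  obtain A s where As: "finite A" "A \<subseteq> {0<..}" "laguerre \<theta> n = nodal A * s"
      "(\<forall>y>0. poly s y \<ge> 0) \<or> (\<forall>y>0. poly s y \<le> 0)"
    using poly_const_sign_factor[OF laguerre_nonzero, of \<theta> n] by (elim exE conjE) (rule that; assumption)
  have s: "s \<noteq> 0" using As(3) laguerre_nonzero[of \<theta> n] by auto
  have deg: "n = card A + degree s"
    using arg_cong[OF As(3), of degree] s nodal_nonzero[of A]
    by (simp add: degree_mult_eq degree_nodal)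
  have "\<not> card A < n"
  proof
    assume "card A < n"
    hence "lag_integral \<theta> (poly (nodal A * laguerre \<theta> n)) = 0"
      by (intro laguerre_orthogonal assms) (simp add: degree_nodal)
    hence zero: "lag_integral \<theta> (poly (nodal A ^ 2 * s)) = 0"
      by (simp add: As(3) power2_eq_square mult.assoc)
    from As(4) show False
    proof
      assume "\<forall>y>0. poly s y \<ge> 0"
      hence "lag_integral \<theta> (poly (nodal A ^ 2 * s)) > 0"
        using s nodal_nonzero by (intro lag_integral_poly_pos assms) auto
      thus False using zero by simp
    next
      assume "\<forall>y>0. poly s y \<le> 0"
      hence "lag_integral \<theta> (poly (smult (-1) (nodal A ^ 2 * s))) > 0"
        using s nodal_nonzero by (intro lag_integral_poly_pos assms) (auto simp: mult_nonneg_nonpos)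
      thus False using zero by (subst (asm) lag_integral_poly_smult[OF assms]) simp
    qed
  qed
  with deg have card: "card A = n" and "degree s = 0" by auto
  then obtain c where c: "s = [:c:]" "c \<noteq> 0" using s by (metis degree_eq_zeroE pCons_0_0)
  have eq: "laguerre \<theta> n = smult c (nodal A)" using As(3) c by simp
  have "laguerre_roots \<theta> n = A"
    using As(1,2) c by (auto simp: laguerre_roots_def eq poly_nodal_0_iff)
  moreover have "c = (-1) ^ n / fact n"
    using arg_cong[OF eq, of "\<lambda>p. coeff p n"] lead_coeff_nodal[of A]
    by (simp add: degree_nodal card coeff_laguerre)
  ultimately show "finite (laguerre_roots \<theta> n)" "card (laguerre_roots \<theta> n) = n"
    "laguerre \<theta> n = smult ((-1) ^ n / fact n) (nodal (laguerre_roots \<theta> n))"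
    using As(1) card eq by auto
qed

section \<open>Lagrange interpolation and Gauss quadrature\<close>

definition lagrange :: "real set \<Rightarrow> real \<Rightarrow> real poly" where
  "lagrange Z a = (\<Prod>r\<in>Z - {a}. smult (1 / (a - r)) [:-r, 1:])"

lemma poly_lagrange: "poly (lagrange Z a) y = (\<Prod>r\<in>Z - {a}. (y - r) / (a - r))"
  by (simp add: lagrange_def poly_prod diff_divide_distrib)

lemma poly_lagrange_node:
  assumes "finite Z" "b \<in> Z"
  shows "poly (lagrange Z a) b = (if a = b then 1 else 0)"
  using assms by (auto simp: poly_lagrange intro!: prod.neutral prod_zero)

lemma degree_lagrange_le:
  assumes "finite Z" "a \<in> Z"
  shows "degree (lagrange Z a) \<le> card Z - 1"
proof -
  have "degree (lagrange Z a) \<le> sum (degree \<circ> (\<lambda>r. smult (1 / (a - r)) [:-r, 1:])) (Z - {a})"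
    unfolding lagrange_def by (rule degree_prod_sum_le) (use assms in auto)
  also have "\<dots> \<le> (\<Sum>r\<in>Z - {a}. 1)" by (intro sum_mono) auto
  finally show ?thesis using assms by simp
qed

text \<open>The Christoffel numbers of the rule with n nodes.\<close>

definition gauss_weight :: "real \<Rightarrow> nat \<Rightarrow> real \<Rightarrow> real" where
  "gauss_weight \<theta> n a = lag_integral \<theta> (poly (lagrange (laguerre_roots \<theta> n) a))"

text \<open>Subtracting the Lagrange interpolant leaves a multiple of the nodal polynomial, hence of
  \<open>laguerre \<theta> n\<close>, whose cofactor has degree below n; orthogonality kills
  it.\<close>

theorem gauss_quadrature:
  assumes "\<theta> > -1" "degree p < 2 * n"
  shows "lag_integral \<theta> (poly p) = (\<Sum>a\<in>laguerre_roots \<theta> n. gauss_weight \<theta> n a * poly p a)"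
proof -
  define Z where "Z = laguerre_roots \<theta> n"
  have fin: "finite Z" and card: "card Z = n"
    using laguerre_roots[OF assms(1)] by (auto simp: Z_def)
  define I where "I = (\<Sum>a\<in>Z. smult (poly p a) (lagrange Z a))"
  have "n > 0" using assms(2) by simp
  have "poly I b = poly p b" if "b \<in> Z" for b
    using fin that by (simp add: I_def poly_sum poly_lagrange_node if_distrib cong: if_cong)
  hence "nodal Z dvd p - I" by (intro nodal_dvd fin) simp
  then obtain q where q: "p - I = nodal Z * q" by (elim dvdE)
  have "degree I \<le> n - 1"
    unfolding I_def using degree_lagrange_le[OF fin] card
    by (intro degree_sum_le fin) (auto intro: degree_smult_le[THEN order_trans])
  hence "degree (p - I) < 2 * n"
    using degree_diff_le_max[of p I] assms(2) by auto
  hence "q = 0 \<or> degree q < n"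
    unfolding q using nodal_nonzero[of Z]
    by (cases "q = 0") (auto simp: degree_mult_eq degree_nodal card)
  hence "lag_integral \<theta> (poly (q * laguerre \<theta> n)) = 0"
    using laguerre_orthogonal[OF assms(1)] by (auto simp: lag_integral_poly_0 simp del: poly_0)
  also have "q * laguerre \<theta> n = smult ((-1) ^ n / fact n) (p - I)"
    unfolding laguerre_eq_nodal[OF assms(1)] q Z_def by (simp add: mult.commute)
  finally have "lag_integral \<theta> (poly p) = lag_integral \<theta> (poly I)"
    by (simp only: lag_integral_poly_smult[OF assms(1)] lag_integral_poly_diff[OF assms(1)]) simp
  also have "poly I = (\<lambda>y. \<Sum>a\<in>Z. poly p a * poly (lagrange Z a) y)"
    by (simp add: I_def poly_sum fun_eq_iff)
  also have "lag_integral \<theta> \<dots> = (\<Sum>a\<in>Z. lag_integral \<theta> (\<lambda>y. poly p a * poly (lagrange Z a) y))"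
    by (intro lag_integrable_sum lag_integrable_cmult lag_integrable_poly assms)
  also have "\<dots> = (\<Sum>a\<in>Z. gauss_weight \<theta> n a * poly p a)"
    by (intro sum.cong refl)
      (simp add: gauss_weight_def lag_integrable_cmult lag_integrable_poly assms Z_def)
  finally show ?thesis by (simp add: Z_def)
qed

text \<open>The square of a Lagrange polynomial has degree at most 2n - 2, so the rule is exact for
  it and returns a single weight.\<close>

lemma gauss_weight_pos:
  assumes "\<theta> > -1" "a \<in> laguerre_roots \<theta> n"
  shows "gauss_weight \<theta> n a > 0"
proof -
  define Z where "Z = laguerre_roots \<theta> n"
  have fin: "finite Z" and card: "card Z = n" and a: "a \<in> Z"
    using laguerre_roots[OF assms(1)] assms by (auto simp: Z_def)
  have "n > 0" using fin a card card_gt_0_iff by blast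
  have "lagrange Z a \<noteq> 0" using poly_lagrange_node[OF fin a, of a] by auto
  hence "0 < lag_integral \<theta> (poly (lagrange Z a ^ 2))"
    by (intro lag_integral_poly_pos assms) auto
  also have "\<dots> = (\<Sum>b\<in>Z. gauss_weight \<theta> n b * poly (lagrange Z a ^ 2) b)"
    unfolding Z_def
    by (rule gauss_quadrature[OF assms(1)])
      (use degree_lagrange_le[OF fin a] \<open>n > 0\<close> in
        \<open>auto simp: card Z_def[symmetric] intro!: degree_power_le[THEN le_less_trans]\<close>)
  also have "\<dots> = gauss_weight \<theta> n a"
    using fin a by (simp add: poly_lagrange_node if_distrib[of "\<lambda>x. x ^ 2"] if_distrib[of "\<lambda>x. _ * x"] cong: if_cong)
  finally show ?thesis .
qed

section \<open>One-sided quadrature estimates\<close>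

text \<open>The polynomials in \<phi> with nonnegative coefficients. The choice \<phi> y = y leads
  to absolutely monotone functions, \<phi> y = 1 / (1 + T y) to completely monotone ones; a divided
  difference multiplies by the sign \<sigma> = 1 or \<sigma> = -1 and otherwise stays in the
  cone.\<close>

inductive_set dd_cone :: "(real \<Rightarrow> real) \<Rightarrow> (real \<Rightarrow> real) set" for \<phi> where
  one: "(\<lambda>_. 1) \<in> dd_cone \<phi>"
| mult: "f \<in> dd_cone \<phi> \<Longrightarrow> (\<lambda>y. \<phi> y * f y) \<in> dd_cone \<phi>"
| add: "f \<in> dd_cone \<phi> \<Longrightarrow> g \<in> dd_cone \<phi> \<Longrightarrow> (\<lambda>y. f y + g y) \<in> dd_cone \<phi>"
| scale: "c \<ge> 0 \<Longrightarrow> f \<in> dd_cone \<phi> \<Longrightarrow> (\<lambda>y. c * f y) \<in> dd_cone \<phi>"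

lemma dd_cone_power: "(\<lambda>y. \<phi> y ^ k) \<in> dd_cone \<phi>"
proof (induction k)
  case (Suc k)
  thus ?case using dd_cone.mult[OF Suc] by simp
qed (simp add: dd_cone.one)

lemma dd_cone_zero: "(\<lambda>_. 0) \<in> dd_cone \<phi>"
  using dd_cone.scale[OF _ dd_cone.one, of 0] by simp

lemma dd_cone_sum: "(\<And>i. i \<in> I \<Longrightarrow> f i \<in> dd_cone \<phi>) \<Longrightarrow> (\<lambda>y. \<Sum>i\<in>I. f i y) \<in> dd_cone \<phi>"
  by (induction I rule: infinite_finite_induct) (auto intro: dd_cone.add dd_cone_zero)

lemma dd_cone_nonneg:
  assumes "f \<in> dd_cone \<phi>" "\<And>y. y > 0 \<Longrightarrow> \<phi> y \<ge> 0" "y > 0"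
  shows "f y \<ge> 0"
  using assms(1) by induction (auto simp: assms(2,3))

text \<open>The Leibniz rule \<phi> f - \<phi>(b) f(b) = \<phi> (f - f(b)) + f(b) (\<phi> -
  \<phi>(b)) reduces everything to the divided difference of \<phi>. Its coefficient f(b) is
  nonnegative, which keeps the result in the cone.\<close>

lemma dd_cone_divided_difference:
  assumes "f \<in> dd_cone \<phi>" "\<And>y. y > 0 \<Longrightarrow> \<phi> y \<ge> 0" "b > 0"
    and "h \<in> dd_cone \<phi>" "\<And>y. y > 0 \<Longrightarrow> \<phi> y - \<phi> b = \<sigma> * (y - b) * h y"
  shows "\<exists>g\<in>dd_cone \<phi>. \<forall>y>0. f y - f b = \<sigma> * (y - b) * g y"
  using assms(1)
proof induction
  case one
  show ?case by (intro bexI[OF _ dd_cone_zero]) auto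
next
  case (mult f)
  then obtain g where g: "g \<in> dd_cone \<phi>" "\<And>y. y > 0 \<Longrightarrow> f y - f b = \<sigma> * (y - b) * g y" by auto
  have "f b \<ge> 0" using mult(1) assms(2,3) by (rule dd_cone_nonneg)
  hence "(\<lambda>y. \<phi> y * g y + f b * h y) \<in> dd_cone \<phi>"
    by (intro dd_cone.add[OF dd_cone.mult[OF g(1)] dd_cone.scale[OF _ assms(4)]])
  moreover have "\<phi> y * f y - \<phi> b * f b = \<sigma> * (y - b) * (\<phi> y * g y + f b * h y)" if "y > 0" for y
    using g(2)[OF that] assms(5)[OF that] by algebra
  ultimately show ?case by (intro bexI[where x = "\<lambda>y. \<phi> y * g y + f b * h y"]) simp
next
  case (add f1 f2)
  then obtain g1 g2 where g: "g1 \<in> dd_cone \<phi>" "\<And>y. y > 0 \<Longrightarrow> f1 y - f1 b = \<sigma> * (y - b) * g1 y"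
    "g2 \<in> dd_cone \<phi>" "\<And>y. y > 0 \<Longrightarrow> f2 y - f2 b = \<sigma> * (y - b) * g2 y" by auto
  have "f1 y + f2 y - (f1 b + f2 b) = \<sigma> * (y - b) * (g1 y + g2 y)" if "y > 0" for y
    using g(2,4)[OF that] by (simp add: algebra_simps)
  thus ?case by (intro bexI[OF _ dd_cone.add[OF g(1,3)]]) simp
next
  case (scale c f)
  then obtain g where g: "g \<in> dd_cone \<phi>" "\<And>y. y > 0 \<Longrightarrow> f y - f b = \<sigma> * (y - b) * g y" by auto
  have "c * f y - c * f b = \<sigma> * (y - b) * (c * g y)" if "y > 0" for y
    using g(2)[OF that] by algebra
  thus ?case by (intro bexI[OF _ dd_cone.scale[OF scale(1) g(1)]]) simp
qed

text \<open>Two divided differences with the same node leave the cone invariant, whatever the sign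
  \<open>\<sigma>\<close>, so the remainder of Hermite interpolation is nonnegative.\<close>
lemma dd_cone_hermite:
  assumes "finite Z" "Z \<subseteq> {0<..}" "f \<in> dd_cone \<phi>"
    and nonneg: "\<And>y. y > 0 \<Longrightarrow> \<phi> y \<ge> 0" and \<sigma>: "\<sigma> * \<sigma> = 1"
    and diff: "\<And>b. b > 0 \<Longrightarrow> \<exists>h\<in>dd_cone \<phi>. \<forall>y>0. \<phi> y - \<phi> b = \<sigma> * (y - b) * h y"
  shows "\<exists>H. \<exists>g\<in>dd_cone \<phi>. (H = 0 \<or> degree H < 2 * card Z) \<and>
    (\<forall>y>0. f y = poly H y + (poly (nodal Z) y)\<^sup>2 * g y)"
  using assms(1,2)
proof induction
  case empty
  \<comment> \<open>For empty \<open>Z\<close> no degree is below 0; this is the reason for the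
    alternative H = 0.\<close>
  show ?case by (intro exI[of _ 0] bexI[OF _ assms(3)]) (auto simp: nodal_def)
next
  case (insert a Z)
  then obtain H g where Hg: "g \<in> dd_cone \<phi>" "H = 0 \<or> degree H < 2 * card Z"
    "\<And>y. y > 0 \<Longrightarrow> f y = poly H y + (poly (nodal Z) y)\<^sup>2 * g y" by auto
  have a: "a > 0" using insert by auto
  obtain h where h: "h \<in> dd_cone \<phi>" "\<And>y. y > 0 \<Longrightarrow> \<phi> y - \<phi> a = \<sigma> * (y - a) * h y"
    using diff[OF a] by blast
  obtain g1 where g1: "g1 \<in> dd_cone \<phi>" "\<And>y. y > 0 \<Longrightarrow> g y - g a = \<sigma> * (y - a) * g1 y"
    using dd_cone_divided_difference[OF Hg(1) nonneg a h] by blast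
  obtain g2 where g2: "g2 \<in> dd_cone \<phi>" "\<And>y. y > 0 \<Longrightarrow> g1 y - g1 a = \<sigma> * (y - a) * g2 y"
    using dd_cone_divided_difference[OF g1(1) nonneg a h] by blast
  \<comment> \<open>\<open>l\<close> is g a + \<sigma> g1(a) (y - a), the linear Hermite interpolant
    of \<open>g\<close> at \<open>a\<close>. The two signs multiply to \<sigma> * \<sigma> = 1, so
    its remainder is (y - a)^2 times \<open>g2\<close>.\<close>
  define l where "l = [:g a - \<sigma> * g1 a * a, \<sigma> * g1 a:]"
  define H' where "H' = H + (nodal Z)\<^sup>2 * l"
  have "degree ((nodal Z)\<^sup>2 * l) \<le> 2 * card Z + 1"
    by (rule degree_mult_le[THEN order_trans])
      (auto simp: l_def degree_power_eq nodal_nonzero degree_nodal)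
  moreover have "degree H \<le> 2 * card Z + 1" using Hg(2) by auto
  ultimately have "degree H' < 2 * card (insert a Z)"
    unfolding H'_def using insert by (auto intro!: degree_add_le[THEN le_less_trans])
  moreover have "f y = poly H' y + (poly (nodal (insert a Z)) y)\<^sup>2 * g2 y" if "y > 0" for y
  proof -
    have "g y = poly l y + (y - a)\<^sup>2 * g2 y"
      using g1(2)[OF that] g2(2)[OF that] \<sigma> unfolding l_def poly_pCons poly_0 by algebra
    moreover have "poly (nodal (insert a Z)) y = (y - a) * poly (nodal Z) y"
      using insert by (simp add: poly_nodal)
    ultimately show ?thesis
      unfolding Hg(3)[OF that] H'_def poly_add poly_mult poly_power by algebra
  qed
  ultimately show ?case using g2(1) by blast
qed

text \<open>The Hermite interpolant agrees with \<open>f\<close> at the nodes, lies below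
  \<open>f\<close>, and has a degree for which the rule is exact.\<close>

lemma gauss_sum_cone_le:
  assumes "\<theta> > -1" "n > 0" "f \<in> dd_cone \<phi>" "lag_integrable \<theta> f"
    and "\<And>y. y > 0 \<Longrightarrow> \<phi> y \<ge> 0" "\<sigma> * \<sigma> = 1"
    and "\<And>b. b > 0 \<Longrightarrow> \<exists>h\<in>dd_cone \<phi>. \<forall>y>0. \<phi> y - \<phi> b = \<sigma> * (y - b) * h y"
  shows "(\<Sum>a\<in>laguerre_roots \<theta> n. gauss_weight \<theta> n a * f a) \<le> lag_integral \<theta> f"
proof -
  define Z where "Z = laguerre_roots \<theta> n"
  have Z: "finite Z" "card Z = n" "Z \<subseteq> {0<..}"
    using laguerre_roots[OF assms(1)] by (auto simp: Z_def laguerre_root_pos)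
  obtain H g where Hg: "g \<in> dd_cone \<phi>" "H = 0 \<or> degree H < 2 * card Z"
    "\<And>y. y > 0 \<Longrightarrow> f y = poly H y + (poly (nodal Z) y)\<^sup>2 * g y"
    using dd_cone_hermite[OF Z(1,3) assms(3,5,6,7)] by blast
  have "f a = poly H a" if "a \<in> Z" for a
    using Hg(3)[of a] that Z by (auto simp: poly_nodal_0_iff)
  hence "(\<Sum>a\<in>Z. gauss_weight \<theta> n a * f a) = (\<Sum>a\<in>Z. gauss_weight \<theta> n a * poly H a)" by simp
  also have "\<dots> = lag_integral \<theta> (poly H)"
    unfolding Z_def by (rule gauss_quadrature[symmetric]) (use assms(1,2) Hg(2) Z in auto)
  also have "\<dots> \<le> lag_integral \<theta> f"
  proof (rule lag_integral_mono[OF lag_integrable_poly(1)[OF assms(1)] assms(4)])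
    fix y :: real assume "y > 0"
    thus "poly H y \<le> f y" using Hg(3)[of y] dd_cone_nonneg[OF Hg(1) assms(5)] by simp
  qed
  finally show ?thesis by (simp add: Z_def)
qed

section \<open>The two families of comparison functions\<close>

text \<open>The exponential itself is not a polynomial, but its Taylor sums lie in the cone because
  c is nonnegative. Their integrals are bounded by that of the exponential, and the finite sum over
  the nodes passes to the limit.\<close>

lemma gauss_sum_exp_le:
  assumes "\<theta> > -1" "n > 0" "0 \<le> c" "c < 1"
  shows "(\<Sum>a\<in>laguerre_roots \<theta> n. gauss_weight \<theta> n a * exp (c * a))
    \<le> Gamma (\<theta> + 1) / (1 - c) powr (\<theta> + 1)"
proof -
  define S where "S N y = (\<Sum>k<N. (c ^ k / fact k) * y ^ k)" for N :: nat and y :: real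
  have S: "(\<lambda>N. S N y) \<longlonglongrightarrow> exp (c * y)" for y
    using exp_converges[of "c * y"] unfolding sums_def S_def
    by (simp add: power_mult_distrib divide_inverse mult_ac)
  have "(\<Sum>a\<in>laguerre_roots \<theta> n. gauss_weight \<theta> n a * S N a) \<le> Gamma (\<theta> + 1) / (1 - c) powr (\<theta> + 1)" for N
  proof -
    have int: "lag_integrable \<theta> (S N)"
      unfolding S_def by (intro lag_integrable_sum lag_integrable_cmult lag_integrable_power assms)
    have "S N \<in> dd_cone (\<lambda>y. y)"
      unfolding S_def using assms(3) by (intro dd_cone_sum dd_cone.scale dd_cone_power) auto
    hence "(\<Sum>a\<in>laguerre_roots \<theta> n. gauss_weight \<theta> n a * S N a) \<le> lag_integral \<theta> (S N)"
      by (rule gauss_sum_cone_le[OF assms(1,2) _ int, where \<sigma> = 1])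
        (auto intro!: bexI[OF _ dd_cone.one])
    also have "\<dots> \<le> lag_integral \<theta> (\<lambda>y. exp (c * y))"
    proof (rule lag_integral_mono[OF int lag_integrable_exp_power(1)])
      fix y :: real assume y: "y > 0"
      show "S N y \<le> exp (c * y)"
      proof (rule LIMSEQ_le_const[OF S])
        show "\<exists>N'. \<forall>m\<ge>N'. S N y \<le> S m y"
          unfolding S_def using y assms(3) by (intro exI[of _ N] allI impI sum_mono2) auto
      qed
    qed (use assms in auto)
    finally show ?thesis using assms by (simp add: lag_integrable_exp_power)
  qed
  moreover have "(\<lambda>N. \<Sum>a\<in>laguerre_roots \<theta> n. gauss_weight \<theta> n a * S N a) \<longlonglongrightarrow>
      (\<Sum>a\<in>laguerre_roots \<theta> n. gauss_weight \<theta> n a * exp (c * a))"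
    by (intro tendsto_intros S)
  ultimately show ?thesis by (intro LIMSEQ_le_const2) auto
qed

text \<open>Split at 1/T and drop exp(-y): the rational factor is at most 1 to the left and at most
  (T y)^{-m} to the right, where m > \<theta> + 1 makes the tail converge. Both parts scale like
  T^{-(\<theta>+1)}.\<close>

lemma lag_integral_rational_le:
  assumes "\<theta> > -1" "T > 0" "real m > \<theta> + 1"
  shows "lag_integrable \<theta> (\<lambda>y. inverse (1 + T * y) ^ m)"
    and "lag_integral \<theta> (\<lambda>y. inverse (1 + T * y) ^ m)
      \<le> (1 / (\<theta> + 1) + 1 / (real m - \<theta> - 1)) * T powr - (\<theta> + 1)"
proof -
  let ?f = "\<lambda>y. inverse (1 + T * y) ^ m"
  let ?F = "\<lambda>y. ?f y * (y powr \<theta> * exp (- y))"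
  have f1: "0 \<le> ?f y" "?f y \<le> 1" if "y \<ge> 0" for y
    using that assms(2) by (auto intro!: power_le_one inverse_le_1_iff[THEN iffD2])
  have "(\<lambda>y. y powr \<theta> * exp (- y)) absolutely_integrable_on {0<..}"
    using absolutely_integrable_Gamma_weight(1)[of "\<theta> + 1" 1] assms(1) by simp
  hence int: "?F absolutely_integrable_on {0<..}"
  proof (rule absolutely_integrable_bounded_measurable_product_real[rotated 3])
    have "1 + T * y \<noteq> 0" if "y > 0" for y
      using that assms(2) by (metis add_pos_pos less_irrefl mult_pos_pos zero_less_one)
    thus "?f \<in> borel_measurable (lebesgue_on {0<..})"
      by (intro continuous_imp_measurable_on_sets_lebesgue continuous_intros) auto
    show "bounded (?f ` {0<..})"
      using f1 by (intro boundedI[of _ 1]) (auto simp: abs_le_iff intro: order_trans[of _ 0])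
  qed auto
  thus "lag_integrable \<theta> ?f" by (simp add: lag_integrable_def)
  define c where "c = 1 / T"
  have c: "c > 0" using assms(2) by (simp add: c_def)
  have I1: "((\<lambda>y. y powr \<theta>) has_integral (c powr (\<theta> + 1) / (\<theta> + 1))) {0..c}"
    by (rule has_integral_powr_from_0) (use assms(1) c in auto)
  have "((\<lambda>y. y powr (\<theta> - m)) has_integral - (c powr (\<theta> - m + 1)) / (\<theta> - m + 1)) {c..}"
    by (rule has_integral_powr_to_inf) (use assms(3) c in auto)
  hence I2: "((\<lambda>y. T powr (- real m) * y powr (\<theta> - m)) has_integral
      T powr (- real m) * (- (c powr (\<theta> - m + 1)) / (\<theta> - m + 1))) {c..}"
    by (rule has_integral_mult_right)
  have sub1: "?F absolutely_integrable_on {0<..c}" "?F absolutely_integrable_on {c..}"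
    by (rule set_integrable_subset[OF int]; use c in auto)+
  have "integral {0<..} ?F = integral {0<..c} ?F + integral {c..} ?F"
  proof -
    have "(?F has_integral (integral {0<..c} ?F + integral {c..} ?F)) ({0<..c} \<union> {c..})"
      using sub1 by (intro has_integral_Un)
        (auto simp: set_lebesgue_integral_eq_integral intro: negligible_subset[of "{c}"])
    moreover have "{0<..c} \<union> {c..} = {0<..}" using c by auto
    ultimately show ?thesis by (intro integral_unique) (simp only:)
  qed
  also have "integral {0<..c} ?F \<le> c powr (\<theta> + 1) / (\<theta> + 1)"
  proof -
    have I3: "((\<lambda>y. y powr \<theta>) has_integral (c powr (\<theta> + 1) / (\<theta> + 1))) {0<..c}"
      using I1 by (subst (asm) has_integral_spike_set_eq[where T = "{0<..c}"])
        (auto intro: negligible_subset[of "{0}"])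
    have "(?F has_integral integral {0<..c} ?F) {0<..c}"
      using sub1 by (auto simp: set_lebesgue_integral_eq_integral)
    moreover have "?F y \<le> y powr \<theta>" if "y \<in> {0<..c}" for y
    proof -
      have "?f y * exp (- y) \<le> 1 * 1" using f1[of y] that by (intro mult_mono) auto
      hence "y powr \<theta> * (?f y * exp (- y)) \<le> y powr \<theta> * 1" by (intro mult_left_mono) auto
      thus ?thesis by (simp add: mult_ac)
    qed
    ultimately show ?thesis by (rule has_integral_le[OF _ I3])
  qed
  also have "integral {c..} ?F \<le> T powr (- real m) * (- (c powr (\<theta> - m + 1)) / (\<theta> - m + 1))"
  proof -
    have "(?F has_integral integral {c..} ?F) {c..}"
      using sub1 by (auto simp: set_lebesgue_integral_eq_integral)
    moreover have "?F y \<le> T powr (- real m) * y powr (\<theta> - m)" if "y \<in> {c..}" for y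
    proof -
      have y: "y > 0" using that c by auto
      have "?f y \<le> inverse (T * y) ^ m"
        using y assms(2) by (intro power_mono le_imp_inverse_le) (auto simp: mult_pos_pos)
      also have "\<dots> = T powr (- real m) * y powr (- real m)"
        using y assms(2) by (simp add: powr_minus powr_realpow power_mult_distrib power_inverse)
      finally have "?f y * exp (- y) \<le> (T powr (- real m) * y powr (- real m)) * 1"
        using y by (intro mult_mono) auto
      hence "y powr \<theta> * (?f y * exp (- y)) \<le> y powr \<theta> * (T powr (- real m) * y powr (- real m))"
        by (intro mult_left_mono) auto
      thus ?thesis by (simp add: mult_ac powr_diff powr_minus divide_inverse)
    qed
    ultimately show ?thesis by (rule has_integral_le[OF _ I2])
  qed
  also have "T powr (- real m) * (- (c powr (\<theta> - m + 1)) / (\<theta> - m + 1)) =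
      T powr - (\<theta> + 1) * (1 / (real m - \<theta> - 1))"
  proof -
    have "c powr (\<theta> - m + 1) = T powr - (\<theta> - m + 1)"
      unfolding powr_minus c_def using assms(2) by (simp add: powr_divide inverse_eq_divide)
    hence "T powr (- real m) * c powr (\<theta> - m + 1) = T powr - (\<theta> + 1)"
      by (simp add: powr_add[symmetric] algebra_simps)
    moreover have "- x / (\<theta> - m + 1) = x * (1 / (real m - \<theta> - 1))" for x
      using assms(3) by (simp add: divide_simps) (simp add: algebra_simps)
    ultimately show ?thesis by simp
  qed
  also have "c powr (\<theta> + 1) / (\<theta> + 1) = T powr - (\<theta> + 1) * (1 / (\<theta> + 1))"
    using assms(2) by (simp add: c_def powr_divide powr_minus inverse_eq_divide del: minus_add_distrib)
  finally show "lag_integral \<theta> ?f \<le> (1 / (\<theta> + 1) + 1 / (real m - \<theta> - 1)) * T powr - (\<theta> + 1)"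
    unfolding lag_integral_def by (simp add: algebra_simps)
qed

lemma gauss_sum_rational_le:
  assumes "\<theta> > -1" "n > 0" "T > 0" "real m > \<theta> + 1"
  shows "(\<Sum>a\<in>laguerre_roots \<theta> n. gauss_weight \<theta> n a * inverse (1 + T * a) ^ m)
    \<le> (1 / (\<theta> + 1) + 1 / (real m - \<theta> - 1)) * T powr - (\<theta> + 1)"
proof -
  let ?\<phi> = "\<lambda>y. inverse (1 + T * y)"
  have "(\<Sum>a\<in>laguerre_roots \<theta> n. gauss_weight \<theta> n a * ?\<phi> a ^ m) \<le> lag_integral \<theta> (\<lambda>y. ?\<phi> y ^ m)"
  proof (rule gauss_sum_cone_le[where \<phi> = ?\<phi> and \<sigma> = "-1"])
    fix b :: real assume b: "b > 0"
    \<comment> \<open>A divided difference of \<phi> is again a multiple of \<phi>, with sign -1.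
      The trailing factor 1 gives the witness the shape produced by the rules \<open>mult\<close>
      and \<open>one\<close>.\<close>
    have "?\<phi> y - ?\<phi> b = -1 * (y - b) * ((T * ?\<phi> b) * (?\<phi> y * 1))" if "y > 0" for y
    proof -
      have "1 + T * y > 0" "1 + T * b > 0" using that b assms(3) by (auto intro!: add_pos_pos)
      thus ?thesis by (simp add: field_simps)
    qed
    moreover have "(\<lambda>y. (T * ?\<phi> b) * (?\<phi> y * 1)) \<in> dd_cone ?\<phi>"
      using assms(3) b by (intro dd_cone.scale dd_cone.mult dd_cone.one) auto
    ultimately show "\<exists>h\<in>dd_cone ?\<phi>. \<forall>y>0. ?\<phi> y - ?\<phi> b = -1 * (y - b) * h y"
      by (intro bexI[where x = "\<lambda>y. (T * ?\<phi> b) * (?\<phi> y * 1)"]) simp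
  qed (use assms lag_integral_rational_le(1) dd_cone_power in auto)
  also have "\<dots> \<le> (1 / (\<theta> + 1) + 1 / (real m - \<theta> - 1)) * T powr - (\<theta> + 1)"
    by (rule lag_integral_rational_le) (use assms in auto)
  finally show ?thesis .
qed

section \<open>Dyadic majorant and size of the zeros\<close>

lemma dyadic_bracket:
  fixes y :: real
  assumes "1 \<le> y" "y \<le> 2 ^ J"
  obtains j where "j \<le> J" "2 ^ j \<le> y" "y < 2 * 2 ^ j"
proof -
  define j where "j = nat \<lfloor>log 2 y\<rfloor>"
  have "log 2 y \<ge> 0" using assms by simp
  hence "real j \<le> log 2 y" "log 2 y < real j + 1" unfolding j_def by linarith+
  hence j: "2 powr real j \<le> y" "y < 2 powr (real j + 1)"
    using assms by (auto simp: le_log_iff log_less_iff)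
  hence *: "2 ^ j \<le> y" "y < 2 * 2 ^ j" by (auto simp: powr_realpow powr_add)
  hence "(2::real) ^ j \<le> 2 ^ J" using assms by linarith
  hence "j \<le> J" by (subst (asm) power_increasing_iff) auto
  thus ?thesis using * that by blast
qed

text \<open>A single summand suffices. If 2^j \<le> y < 2^{j+1}, then y / 2^j < 2 costs a factor
  e^2. If y < 1, bracket 1/y instead: then 2^j y \<le> 1 gives 1 \<le> 2 / (1 + 2^j y), which costs
  2^m, while y^{-s} and e^y cost 2^s and e.\<close>

lemma dyadic_majorant:
  fixes y s :: real
  assumes "s > 0" "y > 0" "y \<le> 2 ^ J" "1 / y \<le> 2 ^ J"
  shows "y powr - s * exp y \<le> (exp 2 + exp 1 * 2 powr s * 2 ^ m) *
    (\<Sum>j\<le>J. (2 ^ j) powr - s * exp ((1 - 1 / 2 ^ j) * y) + (2 ^ j) powr s * inverse (1 + 2 ^ j * y) ^ m)"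
    (is "_ \<le> ?K * (\<Sum>j\<le>J. ?t j)")
proof -
  have t: "?t j \<ge> 0" for j using assms(2) by (auto intro!: add_nonneg_nonneg mult_nonneg_nonneg)
  have "\<exists>j\<le>J. y powr - s * exp y \<le> ?K * ?t j"
  proof (cases "y \<ge> 1")
    case True
    then obtain j where j: "j \<le> J" "2 ^ j \<le> y" "y < 2 * 2 ^ j"
      using dyadic_bracket assms(3) by blast
    have "y powr - s \<le> (2 ^ j) powr - s" using assms j by (intro powr_mono2') auto
    moreover have "exp y \<le> exp 2 * exp ((1 - 1 / 2 ^ j) * y)"
      unfolding exp_add[symmetric] using j by (simp add: field_simps)
    ultimately have "y powr - s * exp y \<le> (2 ^ j) powr - s * (exp 2 * exp ((1 - 1 / 2 ^ j) * y))"
      by (intro mult_mono) auto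
    also have "\<dots> = exp 2 * ((2 ^ j) powr - s * exp ((1 - 1 / 2 ^ j) * y))" by simp
    also have "\<dots> \<le> ?K * ?t j"
      using assms(2) by (intro mult_mono) (auto intro!: mult_nonneg_nonneg add_nonneg_nonneg)
    finally show ?thesis using j(1) by blast
  next
    case False
    hence "1 \<le> 1 / y" using assms(2) by simp
    then obtain j where j: "j \<le> J" "2 ^ j \<le> 1 / y" "1 / y < 2 * 2 ^ j"
      using dyadic_bracket assms(4) by blast
    have "y powr - s = (1 / y) powr s" using assms(2) by (simp add: powr_divide powr_minus inverse_eq_divide)
    also have "\<dots> \<le> (2 * 2 ^ j) powr s" using assms j by (intro powr_mono2) auto
    finally have "y powr - s \<le> 2 powr s * (2 ^ j) powr s" by (simp add: powr_mult)
    hence "y powr - s * exp y \<le> (2 powr s * (2 ^ j) powr s) * exp 1"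
      using False by (intro mult_mono) auto
    also have "\<dots> = exp 1 * 2 powr s * (2 ^ j) powr s" by simp
    also have "\<dots> \<le> exp 1 * 2 powr s * (2 ^ j) powr s * (2 * inverse (1 + 2 ^ j * y)) ^ m"
    proof -
      have "2 ^ j * y \<le> 1" "2 ^ j * y \<ge> 0" using j(2) assms(2) by (auto simp: field_simps)
      hence "1 \<le> 2 * inverse (1 + 2 ^ j * y)" by (simp add: field_simps)
      hence "1 \<le> (2 * inverse (1 + 2 ^ j * y)) ^ m" by (rule one_le_power)
      hence "x * 1 \<le> x * (2 * inverse (1 + 2 ^ j * y)) ^ m" if "x \<ge> 0" for x
        using that by (rule mult_left_mono)
      thus ?thesis by simp
    qed
    also have "\<dots> = (exp 1 * 2 powr s * 2 ^ m) * ((2 ^ j) powr s * inverse (1 + 2 ^ j * y) ^ m)"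
      by (simp add: power_mult_distrib)
    also have "\<dots> \<le> ?K * ?t j"
      using assms(2) by (intro mult_mono) (auto intro!: mult_nonneg_nonneg add_nonneg_nonneg)
    finally show ?thesis using j(1) by blast
  qed
  then obtain j where j: "j \<le> J" "y powr - s * exp y \<le> ?K * ?t j" by blast
  have "?t j \<le> (\<Sum>j\<le>J. ?t j)"
    using j(1) t by (intro member_le_sum) auto
  hence "?K * ?t j \<le> ?K * (\<Sum>j\<le>J. ?t j)" by (intro mult_left_mono) auto
  with j(2) show ?thesis by linarith
qed

lemma coeff_nodal_1:
  assumes "finite A" "0 \<notin> A"
  shows "coeff (nodal A) 1 = - coeff (nodal A) 0 * (\<Sum>a\<in>A. 1 / a)"
  using assms
proof (induction A)
  case (insert a A)
  thus ?case by (simp add: nodal_insert field_simps)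
qed (simp add: nodal_def)

lemma coeff_nodal_sum:
  assumes "finite A" "card A = Suc n"
  shows "coeff (nodal A) n = - (\<Sum>a\<in>A. a)"
  using assms
proof (induction A arbitrary: n)
  case (insert a A)
  have "coeff (nodal A) n = 1"
    using lead_coeff_nodal[of A] insert by (simp add: degree_nodal)
  moreover have "n = 0 \<and> A = {} \<or> (\<exists>k. n = Suc k \<and> card A = Suc k)"
    using insert by (cases n) auto
  ultimately show ?case using insert by (auto simp: nodal_insert coeff_pCons)
qed simp

text \<open>All zeros are positive, so each is at most the sum of all, and likewise for reciprocals;
  both sums are ratios of coefficients. Such crude bounds suffice because only the logarithm of the
  range enters.\<close>

lemma laguerre_root_bounds:
  assumes "\<theta> > -1" "n > 0" "a \<in> laguerre_roots \<theta> n"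
  shows "a \<le> real n * (real n + \<theta>)" and "1 / a \<le> real n / (\<theta> + 1)"
proof -
  define Z where "Z = laguerre_roots \<theta> n"
  have Z: "finite Z" "card Z = n" "a \<in> Z" and pos: "\<And>a. a \<in> Z \<Longrightarrow> a > 0"
    using laguerre_roots[OF assms(1)] assms(3) by (auto simp: Z_def laguerre_root_pos)
  obtain k where k: "n = Suc k" using assms(2) by (cases n) auto
  define C where "C = (-1) ^ n / (fact n :: real)"
  have C: "C \<noteq> 0" by (simp add: C_def)
  have eq: "laguerre \<theta> n = smult C (nodal Z)"
    unfolding C_def Z_def by (rule laguerre_eq_nodal[OF assms(1)])
  have "C * (- (\<Sum>a\<in>Z. a)) = coeff (laguerre \<theta> n) k"
    unfolding eq using coeff_nodal_sum[of Z k] Z k by simp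
  also have "\<dots> = - C * (real n * (real n + \<theta>))"
    by (simp add: coeff_laguerre k C_def field_simps del: of_nat_Suc)
  finally have "(\<Sum>a\<in>Z. a) = real n * (real n + \<theta>)" using C by simp
  moreover have "a \<le> (\<Sum>a\<in>Z. a)" using Z pos by (intro member_le_sum) (auto intro: less_imp_le)
  ultimately show "a \<le> real n * (real n + \<theta>)" by simp
  have "0 \<notin> Z" using pos by force
  have "C * coeff (nodal Z) 0 * (\<Sum>a\<in>Z. 1 / a) = - coeff (laguerre \<theta> n) 1"
    unfolding eq using coeff_nodal_1[OF Z(1) \<open>0 \<notin> Z\<close>] by simp
  also have "\<dots> = (real n + \<theta>) gchoose k" using k by (simp add: coeff_laguerre)
  also have "C * coeff (nodal Z) 0 = coeff (laguerre \<theta> n) 0" unfolding eq by simp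
  also have "\<dots> = (real n + \<theta>) gchoose n" by (simp add: coeff_laguerre)
  also have "\<dots> = ((real n + \<theta>) gchoose k) * ((\<theta> + 1) / real n)"
    using gbinomial_mult_1[of "real n + \<theta>" k] k by (simp add: field_simps)
  finally have "((real n + \<theta>) gchoose k) * ((\<theta> + 1) / real n * (\<Sum>a\<in>Z. 1 / a)) = (real n + \<theta>) gchoose k"
    by (simp add: mult.assoc)
  moreover have "(real n + \<theta>) gchoose k \<noteq> 0"
    using assms(1) k by (simp add: gbinomial_pochhammer' pochhammer_eq_0_iff) 
  ultimately have "(\<theta> + 1) / real n * (\<Sum>a\<in>Z. 1 / a) = 1"
    by (metis mult_cancel_left2)
  hence "(\<Sum>a\<in>Z. 1 / a) = real n / (\<theta> + 1)" using assms(1,2) by (simp add: field_simps)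
  moreover have "1 / a \<le> (\<Sum>a\<in>Z. 1 / a)" using Z pos by (intro member_le_sum) (auto intro: less_imp_le)
  ultimately show "1 / a \<le> real n / (\<theta> + 1)" by simp
qed


text \<open>The majorant has J + 1 scales, each contributing at most a constant to the quadrature
  sum, and J is of order log M.\<close>

theorem gauss_sum_log_bound:
  assumes "\<theta> > -1"
  shows "\<exists>C>0. \<forall>M\<ge>2. (\<Sum>a\<in>laguerre_roots \<theta> (M + 1).
    gauss_weight \<theta> (M + 1) a * (a powr - (\<theta> + 1) * exp a)) \<le> C * ln (real M)"
proof -
  define s where "s = \<theta> + 1"
  have s: "s > 0" using assms by (simp add: s_def)
  define m where "m = nat \<lceil>s\<rceil> + 1"
  have m: "real m > s" unfolding m_def by linarith
  \<comment> \<open>Bounds the contribution of one scale: \<open>Gamma s\<close> for the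
    exponential, the rest for the rational function.\<close>
  define B where "B = Gamma s + (1 / s + 1 / (real m - \<theta> - 1))"
  define K where "K = exp 2 + exp 1 * 2 powr s * 2 ^ m"
  have K: "K > 0" by (auto simp: K_def intro!: add_pos_pos mult_pos_pos)
  have B: "B > 0" using s m by (auto simp: B_def s_def intro!: add_pos_pos Gamma_real_pos)
  \<comment> \<open>Chosen so that R n^2 dominates both n (n + \<theta>) and n / s, the bounds for
    the zeros and their reciprocals.\<close>
  define R where "R = 1 + \<bar>\<theta>\<bar> + 1 / s"
  have R: "R \<ge> 1" using s by (simp add: R_def)
  \<comment> \<open>Absorbs J + 1 \<le> (ln R + 2 ln n + 2 ln 2) / ln 2 into a multiple of ln M:
    since n = M + 1 \<le> M^2 and ln 2 \<le> ln M, the last two terms give 4 + 2 = 6.\<close>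
  define D where "D = (ln R / ln 2 + 6) / ln 2"
  have D: "D > 0" using R by (auto simp: D_def intro!: divide_pos_pos add_nonneg_pos)
  have "(\<Sum>a\<in>laguerre_roots \<theta> (M + 1). gauss_weight \<theta> (M + 1) a * (a powr - s * exp a))
      \<le> (K * B * D) * ln (real M)" if M: "M \<ge> 2" for M
  proof -
    define n where "n = M + 1"
    have n: "n > 0" "real n \<ge> 1" by (auto simp: n_def)
    define Z where "Z = laguerre_roots \<theta> n"
    define w where "w = gauss_weight \<theta> n"
    have w: "w a \<ge> 0" if "a \<in> Z" for a
      using gauss_weight_pos[OF assms] that unfolding Z_def w_def by (simp add: less_imp_le)
    define J where "J = nat \<lceil>log 2 (R * real n ^ 2)\<rceil>"
    have Rn: "R * real n ^ 2 \<ge> 1" using R n mult_mono[of 1 R 1 "real n ^ 2"] by simp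
    hence "log 2 (R * real n ^ 2) \<ge> 0" by simp
    hence J: "log 2 (R * real n ^ 2) \<le> real J" "real J \<le> log 2 (R * real n ^ 2) + 1"
      unfolding J_def by linarith+
    have "R * real n ^ 2 \<le> 2 powr real J"
      using J(1) Rn by (subst (asm) log_le_iff) auto
    hence J2: "R * real n ^ 2 \<le> 2 ^ J" by (simp add: powr_realpow)
    have bounds: "a > 0" "a \<le> 2 ^ J" "1 / a \<le> 2 ^ J" if "a \<in> Z" for a
    proof -
      show "a > 0" using that by (simp add: Z_def laguerre_root_pos)
      have "a \<le> real n * (real n + \<theta>)"
        using laguerre_root_bounds(1)[OF assms n(1)] that by (simp add: Z_def)
      also have "\<dots> \<le> real n * (real n * R)"
      proof -
        have "\<theta> \<le> real n * \<bar>\<theta>\<bar>" using n mult_right_mono[of 1 "real n" "\<bar>\<theta>\<bar>"] by linarith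
        moreover have "real n * (1 / s) \<ge> 0" using s by simp
        ultimately have "real n + \<theta> \<le> real n * R" by (simp add: R_def algebra_simps)
        thus ?thesis by (intro mult_left_mono) auto
      qed
      also have "\<dots> = R * real n ^ 2" by (simp add: power2_eq_square)
      finally show "a \<le> 2 ^ J" using J2 by linarith
      have "1 / a \<le> real n / s"
        using laguerre_root_bounds(2)[OF assms n(1)] that by (simp add: Z_def s_def)
      also have "\<dots> = (1 / s) * real n" by simp
      also have "\<dots> \<le> R * real n ^ 2"
        using s n R by (intro mult_mono) (auto simp: R_def self_le_power)
      finally show "1 / a \<le> 2 ^ J" using J2 by linarith
    qed
    have "(\<Sum>a\<in>Z. w a * (a powr - s * exp a)) \<le> (\<Sum>a\<in>Z. w a * (K * (\<Sum>j\<le>J.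
        (2 ^ j) powr - s * exp ((1 - 1 / 2 ^ j) * a) + (2 ^ j) powr s * inverse (1 + 2 ^ j * a) ^ m)))"
      unfolding K_def using bounds w s by (intro sum_mono mult_left_mono dyadic_majorant) auto
    also have "\<dots> = K * (\<Sum>j\<le>J. (2 ^ j) powr - s * (\<Sum>a\<in>Z. w a * exp ((1 - 1 / 2 ^ j) * a)) +
        (2 ^ j) powr s * (\<Sum>a\<in>Z. w a * inverse (1 + 2 ^ j * a) ^ m))"
      by (subst sum.distrib) (simp add: sum_distrib_left sum.distrib mult_ac distrib_left sum.swap[of _ "{..J}" Z])
    also have "\<dots> \<le> K * (\<Sum>j\<le>J. B)"
    proof (intro mult_left_mono sum_mono)
      fix j
      have "(\<Sum>a\<in>Z. w a * exp ((1 - 1 / 2 ^ j) * a)) \<le> Gamma (\<theta> + 1) / (1 - (1 - 1 / 2 ^ j)) powr (\<theta> + 1)"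
        unfolding Z_def w_def by (rule gauss_sum_exp_le[OF assms n(1)]) auto
      also have "\<dots> = Gamma s * (2 ^ j) powr s"
        by (simp add: s_def powr_divide)
      finally have "(2 ^ j) powr - s * (\<Sum>a\<in>Z. w a * exp ((1 - 1 / 2 ^ j) * a))
          \<le> (2 ^ j) powr - s * (Gamma s * (2 ^ j) powr s)"
        by (intro mult_left_mono) auto
      also have "\<dots> = Gamma s" by (simp add: powr_minus)
      finally have 1: "(2 ^ j) powr - s * (\<Sum>a\<in>Z. w a * exp ((1 - 1 / 2 ^ j) * a)) \<le> Gamma s" .
      have "(\<Sum>a\<in>Z. w a * inverse (1 + 2 ^ j * a) ^ m)
          \<le> (1 / (\<theta> + 1) + 1 / (real m - \<theta> - 1)) * (2 ^ j) powr - (\<theta> + 1)"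
        unfolding Z_def w_def using m by (intro gauss_sum_rational_le[OF assms n(1)]) (auto simp: s_def)
      hence "(2 ^ j) powr s * (\<Sum>a\<in>Z. w a * inverse (1 + 2 ^ j * a) ^ m)
          \<le> (2 ^ j) powr s * ((1 / s + 1 / (real m - \<theta> - 1)) * (2 ^ j) powr - s)"
        unfolding s_def by (intro mult_left_mono) auto
      also have "\<dots> = 1 / s + 1 / (real m - \<theta> - 1)" by (simp add: powr_minus)
      finally show "(2 ^ j) powr - s * (\<Sum>a\<in>Z. w a * exp ((1 - 1 / 2 ^ j) * a)) +
        (2 ^ j) powr s * (\<Sum>a\<in>Z. w a * inverse (1 + 2 ^ j * a) ^ m) \<le> B"
        using 1 by (simp add: B_def)
    qed (use K in auto)
    also have "\<dots> = (K * B) * (real J + 1)" by simp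
    also have "\<dots> \<le> (K * B) * (D * ln (real M))"
    proof (intro mult_left_mono)
      have lnM: "ln 2 \<le> ln (real M)" using M by simp
      have "2 * real M \<le> real M * real M" using M by (intro mult_right_mono) auto
      hence "real n \<le> real M ^ 2" using M unfolding n_def power2_eq_square by linarith
      hence "ln (real n) \<le> ln (real M ^ 2)" using n M by (subst ln_le_cancel_iff) auto
      hence lnn: "ln (real n) \<le> 2 * ln (real M)" using M by (simp add: ln_realpow)
      have "ln R / ln 2 * ln 2 \<le> ln R / ln 2 * ln (real M)"
        using lnM R by (intro mult_left_mono) auto
      hence lnR: "ln R \<le> ln R / ln 2 * ln (real M)" by simp
      have "log 2 (R * real n ^ 2) = (ln R + 2 * ln (real n)) / ln 2"
        using R n by (simp add: log_def ln_mult ln_realpow)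
      hence "real J + 1 \<le> (ln R + 2 * ln (real n)) / ln 2 + 2" using J(2) by simp
      also have "\<dots> = (ln R + 2 * ln (real n) + 2 * ln 2) / ln 2" by (simp add: field_simps)
      also have "\<dots> \<le> (ln R / ln 2 * ln (real M) + 6 * ln (real M)) / ln 2"
        using lnn lnM lnR by (intro divide_right_mono) auto
      also have "\<dots> = D * ln (real M)" by (simp add: D_def field_simps)
      finally show "real J + 1 \<le> D * ln (real M)" .
    qed (use K B in auto)
    finally show ?thesis by (simp add: Z_def w_def n_def mult.assoc)
  qed
  moreover have "K * B * D > 0" using K B D by simp
  ultimately show ?thesis unfolding s_def by blast
qed

section \<open>Weak derivatives of continuous functions\<close>

text \<open>The classical smooth function that vanishes to infinite order at 0; the polynomial
  factor in 1/t makes the family closed under differentiation.\<close>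

definition flat :: "real poly \<Rightarrow> real \<Rightarrow> real" where
  "flat p t = (if t \<le> 0 then 0 else poly p (1 / t) * exp (- (1 / t)))"

lemma tendsto_poly_exp_minus:
  "((\<lambda>x::real. poly p x * exp (- x)) \<longlongrightarrow> 0) at_top"
proof -
  have "((\<lambda>x::real. \<Sum>i\<le>degree p. coeff p i * (x ^ i / exp x)) \<longlongrightarrow> (\<Sum>i\<le>degree p. coeff p i * 0)) at_top"
    by (intro tendsto_intros tendsto_power_div_exp_0)
  thus ?thesis
    by (simp add: poly_altdef sum_distrib_right exp_minus divide_inverse mult.assoc)
qed

lemma tendsto_flat_0: "(flat p \<longlongrightarrow> 0) (at 0)"
proof -
  have "eventually (\<lambda>t. flat p t = 0) (at_left 0)"
    by (auto simp: flat_def eventually_at_filter)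
  hence "(flat p \<longlongrightarrow> 0) (at_left 0)" by (rule tendsto_eventually)
  moreover have "((\<lambda>t::real. poly p (inverse t) * exp (- (inverse t))) \<longlongrightarrow> 0) (at_right 0)"
    by (rule filterlim_compose[OF tendsto_poly_exp_minus filterlim_inverse_at_top_right])
  hence "(flat p \<longlongrightarrow> 0) (at_right 0)"
    by (rule Lim_transform_eventually)
      (auto simp: flat_def eventually_at_filter inverse_eq_divide)
  ultimately show ?thesis by (simp add: filterlim_at_split)
qed

text \<open>With u = 1/t one has d/dt = -u^2 d/du, which sends p(u) e^{-u} to u^2 (p - p')(u)
  e^{-u}; each \<open>pCons 0\<close> is a factor u.\<close>

lemma flat_has_derivative:
  "(flat p has_real_derivative flat (pCons 0 (pCons 0 (p - pderiv p))) t) (at t)"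
proof -
  consider "t < 0" | "t = 0" | "t > 0" by linarith
  thus ?thesis
  proof cases
    case 1
    have "((\<lambda>_. 0) has_real_derivative 0) (at t)" by simp
    hence "(flat p has_real_derivative 0) (at t)"
      by (rule has_field_derivative_transform_within_open[where S = "{..<0}"])
        (use 1 in \<open>auto simp: flat_def\<close>)
    thus ?thesis using 1 by (simp add: flat_def)
  next
    case 2
    \<comment> \<open>The difference quotient at 0 is again of the form \<open>flat\<close>, so it
      tends to 0.\<close>
    have "flat (pCons 0 p) h = (flat p (0 + h) - flat p 0) / h" if "h \<noteq> 0" for h
      using that by (auto simp: flat_def field_simps)
    hence "((\<lambda>h. (flat p (0 + h) - flat p 0) / h) \<longlongrightarrow> 0) (at 0)"
      by (intro Lim_transform_eventually[OF tendsto_flat_0[of "pCons 0 p"]])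
        (auto simp: eventually_at_filter)
    thus ?thesis using 2 by (simp add: DERIV_def flat_def)
  next
    case 3
    have "((\<lambda>t. poly p (1 / t) * exp (- (1 / t))) has_real_derivative
        poly (pCons 0 (pCons 0 (p - pderiv p))) (1 / t) * exp (- (1 / t))) (at t)"
      using 3 by (auto intro!: derivative_eq_intros DERIV_chain'[OF _ poly_DERIV] simp: field_simps power2_eq_square)
    hence "(flat p has_real_derivative poly (pCons 0 (pCons 0 (p - pderiv p))) (1 / t) * exp (- (1 / t))) (at t)"
      by (rule has_field_derivative_transform_within_open[where S = "{0<..}"])
        (use 3 in \<open>auto simp: flat_def\<close>)
    thus ?thesis using 3 by (simp add: flat_def)
  qed
qed

lemma continuous_on_flat [continuous_intros]:
  "continuous_on A f \<Longrightarrow> continuous_on A (\<lambda>x. flat p (f x))"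
  by (rule continuous_on_compose2[of UNIV "flat p"])
    (auto intro: DERIV_isCont flat_has_derivative continuous_at_imp_continuous_on)

lemma deriv_iterates_differentiable:
  fixes f :: "real \<Rightarrow> real"
  assumes "\<And>f. f \<in> K \<Longrightarrow> \<exists>f'\<in>K. \<forall>x. (f has_real_derivative f' x) (at x)" "f \<in> K"
  shows "(deriv ^^ k) f field_differentiable at x"
proof -
  have "(deriv ^^ k) f \<in> K"
  proof (induction k)
    case (Suc k)
    then obtain f' where "f' \<in> K" "\<And>x. ((deriv ^^ k) f has_real_derivative f' x) (at x)"
      using assms(1) by metis
    moreover from this have "deriv ((deriv ^^ k) f) = f'" by (auto intro: DERIV_imp_deriv)
    ultimately show ?case by simp
  qed (simp add: assms(2))
  thus ?thesis using assms(1) unfolding field_differentiable_def by blast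
qed

text \<open>Closed under differentiation by the product rule. Scalar factors need no rule of their
  own: \<open>flat_smult\<close> moves them into the polynomial.\<close>

inductive_set flat_span :: "(real \<Rightarrow> real) set" where
  prod: "(\<lambda>x. flat p (c * x + d) * flat q (c' * x + d')) \<in> flat_span"
| add: "f \<in> flat_span \<Longrightarrow> g \<in> flat_span \<Longrightarrow> (\<lambda>x. f x + g x) \<in> flat_span"

lemma flat_smult: "flat (smult c p) t = c * flat p t"
  by (simp add: flat_def)

lemma flat_span_derivative:
  "f \<in> flat_span \<Longrightarrow> \<exists>f'\<in>flat_span. \<forall>x. (f has_real_derivative f' x) (at x)"
proof (induction rule: flat_span.induct)
  case (prod p c d q c' d')
  define p' q' where "p' = pCons 0 (pCons 0 (p - pderiv p))" and "q' = pCons 0 (pCons 0 (q - pderiv q))"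
  have "((\<lambda>x. flat p (c * x + d) * flat q (c' * x + d')) has_real_derivative
      flat (smult c p') (c * x + d) * flat q (c' * x + d') +
      flat p (c * x + d) * flat (smult c' q') (c' * x + d')) (at x)" for x
    unfolding p'_def q'_def flat_smult
    by (rule derivative_eq_intros refl
        DERIV_chain'[where f = "\<lambda>x. c * x + d" and g = "flat p", OF _ flat_has_derivative]
        DERIV_chain'[where f = "\<lambda>x. c' * x + d'" and g = "flat q", OF _ flat_has_derivative])+
      (simp add: algebra_simps)
  thus ?case by (intro bexI[OF _ flat_span.add[OF flat_span.prod flat_span.prod]]) blast
next
  case (add f g)
  then obtain f' g' where "f' \<in> flat_span" "g' \<in> flat_span"
    "\<And>x. (f has_real_derivative f' x) (at x)" "\<And>x. (g has_real_derivative g' x) (at x)" by auto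
  thus ?case by (intro bexI[where x = "\<lambda>x. f' x + g' x"] flat_span.add) (auto intro!: DERIV_add)
qed

text \<open>The support extends to the right of \<open>a\<close>, so for a > 0 it stays in the half
  line however large \<open>e\<close> is.\<close>

definition bump :: "real \<Rightarrow> real \<Rightarrow> real \<Rightarrow> real" where
  "bump a e x = flat 1 (x - a) * flat 1 (a + e - x)"

definition mollifier :: "real \<Rightarrow> real \<Rightarrow> real \<Rightarrow> real" where
  "mollifier a e x = bump a e x / integral {a..a + e} (bump a e)"

lemma bump_nonneg: "bump a e x \<ge> 0"
  by (simp add: bump_def flat_def)

lemma continuous_on_bump: "continuous_on A (bump a e)"
  unfolding bump_def by (intro continuous_intros)

lemma bump_integral_pos:
  assumes "e > 0"
  shows "integral {a..a + e} (bump a e) > 0"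
proof -
  have int: "bump a e integrable_on {a..a + e}"
    by (intro integrable_continuous_real continuous_on_bump)
  have "integral {a..a + e} (bump a e) \<ge> 0"
    by (intro Henstock_Kurzweil_Integration.integral_nonneg int) (auto simp: bump_nonneg)
  moreover have "integral {a..a + e} (bump a e) \<noteq> 0"
  proof
    assume "integral {a..a + e} (bump a e) = 0"
    hence "(bump a e has_integral 0) (cbox a (a + e))"
      using int by (simp add: has_integral_iff)
    hence "bump a e (a + e / 2) = 0"
      by (rule has_integral_0_cbox_imp_0[rotated 2])
        (use assms in \<open>auto simp: bump_nonneg continuous_on_bump\<close>)
    thus False using assms by (simp add: bump_def flat_def)
  qed
  ultimately show ?thesis by simp
qed

lemma mollifier_nonneg: "e > 0 \<Longrightarrow> mollifier a e x \<ge> 0"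
  using bump_integral_pos[of e a] by (simp add: mollifier_def bump_nonneg)

lemma continuous_on_mollifier: "continuous_on A (mollifier a e)"
proof -
  have "continuous_on A (\<lambda>x. inverse (integral {a..a + e} (bump a e)) * bump a e x)"
    by (intro continuous_intros continuous_on_bump)
  thus ?thesis by (simp add: mollifier_def[abs_def] divide_inverse mult.commute)
qed

lemma mollifier_outside: "x \<le> a \<or> a + e \<le> x \<Longrightarrow> mollifier a e x = 0"
  by (auto simp: mollifier_def bump_def flat_def)

lemma mollifier_has_integral:
  assumes "e > 0"
  shows "(mollifier a e has_integral 1) {a..a + e}"
proof -
  have "(bump a e has_integral integral {a..a + e} (bump a e)) {a..a + e}"
    by (intro integrable_integral integrable_continuous_real continuous_on_bump)
  from has_integral_divide[OF this, of "integral {a..a + e} (bump a e)"]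
  show ?thesis using bump_integral_pos[OF assms, of a] by (simp add: mollifier_def[abs_def])
qed

lemma mollifier_in_flat_span: "(\<lambda>x. c * mollifier a e x) \<in> flat_span"
proof -
  let ?k = "c * inverse (integral {a..a + e} (bump a e))"
  have "(\<lambda>x. flat (smult ?k 1) (1 * x + - a) * flat 1 (- 1 * x + (a + e))) \<in> flat_span"
    by (rule flat_span.prod)
  also have "(\<lambda>x. flat (smult ?k 1) (1 * x + - a) * flat 1 (- 1 * x + (a + e))) = (\<lambda>x. c * mollifier a e x)"
    unfolding flat_smult by (auto simp: mollifier_def bump_def divide_inverse mult_ac)
  finally show ?thesis .
qed

lemma mollifier_integral_bounds:
  assumes "e > 0"
  shows "integral {c..x} (mollifier a e) \<in> {0..1}"
    and "c \<le> a \<Longrightarrow> a + e \<le> x \<Longrightarrow> integral {c..x} (mollifier a e) = 1"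
    and "x \<le> a \<Longrightarrow> integral {c..x} (mollifier a e) = 0"
proof -
  let ?m = "mollifier a e"
  have int: "?m integrable_on {c..x}" for c x
    by (intro integrable_continuous_real continuous_on_mollifier)
  have full: "integral {c..x} ?m = 1" if "c \<le> a" "a + e \<le> x" for c x
  proof -
    have "(?m has_integral 1) {c..x}"
      using mollifier_has_integral[OF assms, of a] that
      by (subst has_integral_spike_set_eq[where T = "{a..a + e}"])
        (auto intro!: negligible_subset[of "{}"] simp: mollifier_outside)
    thus ?thesis by (rule integral_unique)
  qed
  thus "c \<le> a \<Longrightarrow> a + e \<le> x \<Longrightarrow> integral {c..x} ?m = 1" by blast
  have "integral {c..x} ?m \<le> integral {min c a..max x (a + e)} ?m"
    by (intro integral_subset_le int) (use assms in \<open>auto simp: mollifier_nonneg\<close>)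
  also have "\<dots> = 1" by (intro full) auto
  finally have "integral {c..x} ?m \<le> 1" .
  moreover have "integral {c..x} ?m \<ge> 0"
    by (intro Henstock_Kurzweil_Integration.integral_nonneg int) (use assms in \<open>auto simp: mollifier_nonneg\<close>)
  ultimately show "integral {c..x} ?m \<in> {0..1}" by simp
  show "integral {c..x} ?m = 0" if "x \<le> a"
    using that integral_cong[of "{c..x}" ?m "\<lambda>_. 0"] by (simp add: mollifier_outside)
qed

text \<open>The lower limit \<open>a / 2\<close> only has to lie strictly to the left of \<open>a\<close>, where the mollifiers
  vanish. As \<open>e\<close> tends to 0 the step tends to the indicator function of \<open>{a<..b}\<close>.\<close>
definition smooth_step :: "real \<Rightarrow> real \<Rightarrow> real \<Rightarrow> real \<Rightarrow> real" where
  "smooth_step a b e x = integral {a / 2..x} (mollifier a e) - integral {a / 2..x} (mollifier b e)"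

text \<open>To the left of \<open>a\<close> the step vanishes identically; from \<open>a\<close> on,
  x is interior to {a / 2..x + 1}, where the one-sided derivative of the integral is
  two-sided.\<close>

lemma smooth_step_derivative:
  assumes "0 < a" "a < b" "e > 0"
  shows "(smooth_step a b e has_real_derivative mollifier a e x - mollifier b e x) (at x)"
proof (cases "x < a")
  case True
  have "((\<lambda>_. 0) has_real_derivative 0) (at x)" by simp
  hence "(smooth_step a b e has_real_derivative 0) (at x)"
    by (rule has_field_derivative_transform_within_open[where S = "{..<a}"])
      (use True assms in \<open>auto simp: smooth_step_def mollifier_integral_bounds(3)\<close>)
  thus ?thesis using True assms by (simp add: mollifier_outside)
next
  case False
  have "((\<lambda>u. integral {a / 2..u} (mollifier d e)) has_real_derivative mollifier d e x) (at x within {a / 2..x + 1})" for d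
    by (rule integral_has_real_derivative) (use False assms in \<open>auto simp: continuous_on_mollifier\<close>)
  moreover have "at x within {a / 2..x + 1} = at x"
    using False assms by (intro at_within_interior) auto
  ultimately show ?thesis unfolding smooth_step_def[abs_def] by (auto intro!: DERIV_diff)
qed

lemma smooth_step_values:
  assumes "0 < a" "a < b" "e > 0"
  shows "\<bar>smooth_step a b e x\<bar> \<le> 1"
    and "x \<le> a \<or> b + e \<le> x \<Longrightarrow> smooth_step a b e x = 0"
    and "a + e \<le> x \<Longrightarrow> x \<le> b \<Longrightarrow> smooth_step a b e x = 1"
proof -
  show "\<bar>smooth_step a b e x\<bar> \<le> 1"
    using mollifier_integral_bounds(1)[OF assms(3), of "a / 2" x a]
      mollifier_integral_bounds(1)[OF assms(3), of "a / 2" x b]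
    by (auto simp: smooth_step_def abs_le_iff)
qed (use assms in \<open>auto simp: smooth_step_def mollifier_integral_bounds(2,3)\<close>)

text \<open>The step itself is an integral and is not shown to lie in \<open>flat_span\<close>, but
  its derivative does; adjoining it to the span still gives a class closed under
  differentiation.\<close>

lemma test_function_smooth_step:
  assumes "0 < a" "a < b" "e > 0"
  shows "test_function (smooth_step a b e)"
  unfolding test_function_def
proof (intro conjI allI exI)
  let ?m = "\<lambda>x. 1 * mollifier a e x + (- 1) * mollifier b e x"
  have "?m \<in> flat_span"
    by (intro flat_span.add mollifier_in_flat_span)
  moreover have "(smooth_step a b e has_real_derivative ?m x) (at x)" for x
    using smooth_step_derivative[OF assms] by simp
  ultimately have "\<exists>f'\<in>flat_span. \<forall>x. (smooth_step a b e has_real_derivative f' x) (at x)"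
    by (intro bexI[where x = ?m]) auto
  hence "\<exists>f'\<in>flat_span. \<forall>x. (f has_real_derivative f' x) (at x)"
    if "f \<in> insert (smooth_step a b e) flat_span" for f
    using that flat_span_derivative[of f] by auto
  hence "\<exists>f'\<in>insert (smooth_step a b e) flat_span. \<forall>x. (f has_real_derivative f' x) (at x)"
    if "f \<in> insert (smooth_step a b e) flat_span" for f
    using that by auto
  thus "(deriv ^^ k) (smooth_step a b e) field_differentiable at x" for k x
    by (rule deriv_iterates_differentiable) auto
  show "compact {a..b + e}" by simp
  show "{a..b + e} \<subseteq> half_line" using assms by auto
  fix x
  show "x \<notin> {a..b + e} \<longrightarrow> smooth_step a b e x = 0"
    using smooth_step_values(2)[OF assms] by (auto simp: not_le less_imp_le)
qed


section \<open>The fundamental theorem of calculus for weak derivatives\<close>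

lemma mollifier_product:
  assumes "continuous_on half_line v" "c > 0" "e > 0"
  shows "set_integrable lebesgue half_line (\<lambda>x. v x * mollifier c e x)"
    and "(LINT x:half_line|lebesgue. v x * mollifier c e x) = integral {c..c + e} (\<lambda>x. v x * mollifier c e x)"
proof -
  have "continuous_on {c..c + e} v"
    by (rule continuous_on_subset[OF assms(1)]) (use assms(2) in auto)
  hence int: "(\<lambda>x. v x * mollifier c e x) absolutely_integrable_on {c..c + e}"
    by (intro absolutely_integrable_continuous_real continuous_intros continuous_on_mollifier)
  have eq: "indicator half_line x *\<^sub>R (v x * mollifier c e x) =
      indicator {c..c + e} x *\<^sub>R (v x * mollifier c e x)" for x
    using assms(2) by (auto simp: indicator_def mollifier_outside)
  show "set_integrable lebesgue half_line (\<lambda>x. v x * mollifier c e x)"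
    using int unfolding set_integrable_def eq .
  show "(LINT x:half_line|lebesgue. v x * mollifier c e x) = integral {c..c + e} (\<lambda>x. v x * mollifier c e x)"
    using set_lebesgue_integral_eq_integral(2)[OF int]
    unfolding set_lebesgue_integral_def eq .
qed

lemma mollifier_tendsto:
  assumes "continuous_on half_line v" "c > 0"
  shows "(\<lambda>n. integral {c..c + 1 / real (Suc n)} (\<lambda>x. v x * mollifier c (1 / real (Suc n)) x)) \<longlonglongrightarrow> v c"
proof (rule LIMSEQ_I)
  fix r :: real assume r: "r > 0"
  have "continuous (at c) v"
    using assms by (simp add: continuous_on_eq_continuous_at)
  then obtain d where d: "d > 0" "\<And>x. \<bar>x - c\<bar> < d \<Longrightarrow> \<bar>v x - v c\<bar> < r / 2"
    using r unfolding continuous_at_eps_delta dist_real_def by (meson half_gt_zero)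
  obtain N :: nat where N: "1 / real (Suc N) < d" using d(1) nat_approx_posE by metis
  have "norm (integral {c..c + 1 / real (Suc n)} (\<lambda>x. v x * mollifier c (1 / real (Suc n)) x) - v c) < r"
    if "n \<ge> N" for n
  proof -
    define e where "e = 1 / real (Suc n)"
    have e: "e > 0" by (simp add: e_def)
    have "e \<le> 1 / real (Suc N)" using that by (simp add: e_def field_simps)
    hence ed: "e < d" using N by simp
    have cv: "continuous_on {c..c + e} v"
      by (rule continuous_on_subset[OF assms(1)]) (use assms(2) in auto)
    have int: "(\<lambda>x. v x * mollifier c e x) integrable_on {c..c + e}"
      "(\<lambda>x. (v x - v c) * mollifier c e x) integrable_on {c..c + e}"
      "(\<lambda>x. v c * mollifier c e x) integrable_on {c..c + e}"
      by (intro integrable_continuous_real continuous_intros continuous_on_mollifier cv)+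
    have "integral {c..c + e} (\<lambda>x. v x * mollifier c e x) =
        integral {c..c + e} (\<lambda>x. (v x - v c) * mollifier c e x + v c * mollifier c e x)"
      by (simp add: algebra_simps)
    also have "\<dots> = integral {c..c + e} (\<lambda>x. (v x - v c) * mollifier c e x) + v c"
      using mollifier_has_integral[OF e, of c] int
      by (subst Henstock_Kurzweil_Integration.integral_add) (auto simp: has_integral_iff)
    finally have "norm (integral {c..c + e} (\<lambda>x. v x * mollifier c e x) - v c) =
        norm (integral {c..c + e} (\<lambda>x. (v x - v c) * mollifier c e x))" by simp
    also have "\<dots> \<le> integral {c..c + e} (\<lambda>x. r / 2 * mollifier c e x)"
    proof (rule integral_norm_bound_integral)
      fix x assume "x \<in> {c..c + e}"
      hence "\<bar>v x - v c\<bar> \<le> r / 2" using d(2)[of x] ed by auto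
      thus "norm ((v x - v c) * mollifier c e x) \<le> r / 2 * mollifier c e x"
        using mult_right_mono[OF _ mollifier_nonneg[OF e, of c x], of "\<bar>v x - v c\<bar>" "r / 2"]
          mollifier_nonneg[OF e, of c x] by (simp add: abs_mult)
    qed (use int in \<open>auto intro!: integrable_continuous_real continuous_intros continuous_on_mollifier\<close>)
    also have "\<dots> = r / 2" using mollifier_has_integral[OF e, of c] by (simp add: has_integral_iff)
    finally show ?thesis using r unfolding e_def by linarith
  qed
  thus "\<exists>no. \<forall>n\<ge>no. norm (integral {c..c + 1 / real (Suc n)} (\<lambda>x. v x * mollifier c (1 / real (Suc n)) x) - v c) < r"
    by blast
qed

text \<open>Test with smooth steps. The derivative of a step is a difference of mollifiers at
  \<open>a\<close> and \<open>b\<close>, so one side tends to v a - v b by continuity; the other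
  tends to minus the integral of \<open>g\<close> by dominated convergence.\<close>

theorem weak_deriv_fundamental_theorem:
  assumes "continuous_on half_line v" "has_weak_deriv v g" "0 < a" "a < b"
  shows "g absolutely_integrable_on {a..b}" and "v b - v a = integral {a..b} g"
proof -
  define e where "e n = 1 / real (Suc n)" for n
  have e: "e n > 0" "e n \<le> 1" for n by (auto simp: e_def)
  define \<phi> where "\<phi> n = smooth_step a b (e n)" for n
  have locint: "g absolutely_integrable_on {a..d}" for d
  proof -
    have "compact {a..d}" "{a..d} \<subseteq> half_line" using assms(3) by auto
    thus ?thesis using assms(2) unfolding has_weak_deriv_def locally_integrable_def by blast
  qed
  thus int: "g absolutely_integrable_on {a..b}" .
  have deriv: "deriv (\<phi> n) x = mollifier a (e n) x - mollifier b (e n) x" for n x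
    unfolding \<phi>_def by (intro DERIV_imp_deriv smooth_step_derivative assms(3,4) e)
  have cont: "continuous_on UNIV (\<phi> n)" for n
    unfolding \<phi>_def using smooth_step_derivative[OF assms(3,4) e(1)]
    by (intro continuous_at_imp_continuous_on) (auto intro: DERIV_isCont)
  have weak: "(LINT x:half_line|lebesgue. v x * deriv (\<phi> n) x) = - (LINT x:half_line|lebesgue. g x * \<phi> n x)" for n
    using assms(2) test_function_smooth_step[OF assms(3,4) e(1)]
    unfolding has_weak_deriv_def \<phi>_def by blast
  have val: "(LINT x:half_line|lebesgue. v x * deriv (\<phi> n) x) =
      integral {a..a + e n} (\<lambda>x. v x * mollifier a (e n) x) - integral {b..b + e n} (\<lambda>x. v x * mollifier b (e n) x)" for n
    using mollifier_product[OF assms(1) _ e(1)] assms(3,4)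
    by (simp add: deriv right_diff_distrib)
  have "(\<lambda>n. integral {a..a + e n} (\<lambda>x. v x * mollifier a (e n) x) -
      integral {b..b + e n} (\<lambda>x. v x * mollifier b (e n) x)) \<longlonglongrightarrow> v a - v b"
    unfolding e_def using assms by (intro tendsto_diff mollifier_tendsto) auto
  hence "(\<lambda>n. - (LINT x:half_line|lebesgue. g x * \<phi> n x)) \<longlonglongrightarrow> v a - v b"
    unfolding weak[symmetric] val .
  from tendsto_minus[OF this]
  have lim1: "(\<lambda>n. LINT x:half_line|lebesgue. g x * \<phi> n x) \<longlonglongrightarrow> - (v a - v b)"
    by simp
  have "(\<lambda>n. integral\<^sup>L lebesgue (\<lambda>x. indicator half_line x *\<^sub>R (g x * \<phi> n x))) \<longlonglongrightarrow>
      integral\<^sup>L lebesgue (\<lambda>x. indicator {a<..b} x *\<^sub>R g x)"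
  \<comment> \<open>As e n \<le> 1, all steps live on [a, b + 1] and are bounded by 1, so
    \<bar>g\<bar> on that interval dominates.\<close>
  proof (rule integral_dominated_convergence[where w = "\<lambda>x. norm (indicator {a..b + 1} x *\<^sub>R g x)"])
    have g: "integrable lebesgue (\<lambda>x. indicator {a..b + 1} x *\<^sub>R g x)"
      using locint[of "b + 1"] by (simp add: set_integrable_def)
    thus "integrable lebesgue (\<lambda>x. norm (indicator {a..b + 1} x *\<^sub>R g x))" by (rule integrable_norm)
    have "set_integrable lebesgue {a<..b} g" by (rule set_integrable_subset[OF int]) auto
    thus "(\<lambda>x. indicator {a<..b} x *\<^sub>R g x) \<in> borel_measurable lebesgue"
      by (auto simp: set_integrable_def)
    have out: "\<phi> n x = 0" if "x \<le> a \<or> b + 1 \<le> x" for n x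
      using that e(2)[of n] smooth_step_values(2)[OF assms(3,4) e(1)] unfolding \<phi>_def by force
    have eq: "indicator half_line x *\<^sub>R (g x * \<phi> n x) = (indicator {a..b + 1} x *\<^sub>R g x) * \<phi> n x" for n x
      using out assms(3) by (auto simp: indicator_def)
    have "\<phi> n \<in> borel_measurable lebesgue" for n
      by (intro measurable_completion) (simp add: borel_measurable_continuous_onI[OF cont])
    thus "(\<lambda>x. indicator half_line x *\<^sub>R (g x * \<phi> n x)) \<in> borel_measurable lebesgue" for n
      unfolding eq using g by (intro borel_measurable_times) auto
    show "AE x in lebesgue. norm (indicator half_line x *\<^sub>R (g x * \<phi> n x)) \<le> norm (indicator {a..b + 1} x *\<^sub>R g x)" for n
    proof (rule AE_I2)
      fix x
      have "\<bar>\<phi> n x\<bar> \<le> 1" unfolding \<phi>_def by (rule smooth_step_values(1)[OF assms(3,4) e(1)])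
      thus "norm (indicator half_line x *\<^sub>R (g x * \<phi> n x)) \<le> norm (indicator {a..b + 1} x *\<^sub>R g x)"
        unfolding eq norm_mult by (simp add: mult_left_le)
    qed
    show "AE x in lebesgue. (\<lambda>n. indicator half_line x *\<^sub>R (g x * \<phi> n x)) \<longlonglongrightarrow> indicator {a<..b} x *\<^sub>R g x"
    proof (rule AE_I2)
      fix x
      have e0: "e \<longlonglongrightarrow> 0" unfolding e_def using LIMSEQ_inverse_real_of_nat by (simp add: inverse_eq_divide)
      have "(\<lambda>n. \<phi> n x) \<longlonglongrightarrow> indicator {a<..b} x"
      proof (rule tendsto_eventually)
        consider "x \<le> a" | "a < x" "x \<le> b" | "b < x" by linarith
        thus "\<forall>\<^sub>F n in sequentially. \<phi> n x = indicator {a<..b} x"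
        proof cases
          case 1
          thus ?thesis using out by simp
        next
          case 2
          hence "\<forall>\<^sub>F n in sequentially. e n < x - a" using order_tendstoD(2)[OF e0, of "x - a"] by simp
          thus ?thesis
            by eventually_elim (use 2 smooth_step_values(3)[OF assms(3,4) e(1)] in \<open>simp add: \<phi>_def\<close>)
        next
          case 3
          hence "\<forall>\<^sub>F n in sequentially. e n < x - b" using order_tendstoD(2)[OF e0, of "x - b"] by simp
          thus ?thesis
            by eventually_elim (use 3 smooth_step_values(2)[OF assms(3,4) e(1)] in \<open>simp add: \<phi>_def\<close>)
        qed
      qed
      hence "(\<lambda>n. indicator half_line x *\<^sub>R (g x * \<phi> n x)) \<longlonglongrightarrow> indicator half_line x *\<^sub>R (g x * indicator {a<..b} x)"
        by (intro tendsto_intros)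
      also have "indicator half_line x *\<^sub>R (g x * indicator {a<..b} x) = indicator {a<..b} x *\<^sub>R g x"
        using assms(3) by (auto simp: indicator_def)
      finally show "(\<lambda>n. indicator half_line x *\<^sub>R (g x * \<phi> n x)) \<longlonglongrightarrow> indicator {a<..b} x *\<^sub>R g x" .
    qed
  qed
  hence "- (v a - v b) = integral\<^sup>L lebesgue (\<lambda>x. indicator {a<..b} x *\<^sub>R g x)"
    using lim1 unfolding set_lebesgue_integral_def by (rule LIMSEQ_unique[rotated])
  also have "\<dots> = integral {a<..b} g"
    using set_lebesgue_integral_eq_integral(2)[OF set_integrable_subset[OF int, of "{a<..b}"]]
    by (simp add: set_lebesgue_integral_def greaterThanAtMost_subseteq_atLeastAtMost_iff)
  also have "\<dots> = integral {a..b} g"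
    by (rule integral_spike_set) (auto intro: negligible_subset[of "{a}"])
  finally show "v b - v a = integral {a..b} g" by simp
qed

section \<open>The mapped weighted spaces\<close>

definition lag_map :: "real \<Rightarrow> real \<Rightarrow> real \<Rightarrow> real" where
  "lag_map \<beta> \<gamma> x = (\<beta> + 1) * x powr \<gamma>"

definition lag_map_deriv :: "real \<Rightarrow> real \<Rightarrow> real \<Rightarrow> real" where
  "lag_map_deriv \<beta> \<gamma> x = (\<beta> + 1) * \<gamma> * x powr (\<gamma> - 1)"

lemma has_weak_deriv_weak_deriv: "has_weak_deriv v g \<Longrightarrow> has_weak_deriv v (weak_deriv v)"
  unfolding weak_deriv_def by (rule someI[of "has_weak_deriv v"])

text \<open>Integrate 0 \<le> p (g - c / p)^2 and take c = G / D, where G is the integral of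
  \<open>g\<close>. Only an upper bound \<open>D\<close> for the integral of 1 / p is
  required.\<close>

lemma Cauchy_Schwarz_weighted:
  fixes g p :: "real \<Rightarrow> real"
  assumes g: "g absolutely_integrable_on S" and gp: "(\<lambda>t. (g t)\<^sup>2 * p t) absolutely_integrable_on S"
    and p: "\<And>t. t \<in> S \<Longrightarrow> p t > 0" "(\<lambda>t. 1 / p t) absolutely_integrable_on S"
    and D: "integral S (\<lambda>t. 1 / p t) \<le> D" "D > 0"
  shows "(integral S g)\<^sup>2 \<le> integral S (\<lambda>t. (g t)\<^sup>2 * p t) * D"
proof -
  define G A where "G = integral S g" and "A = integral S (\<lambda>t. (g t)\<^sup>2 * p t)"
  define c where "c = G / D"
  note [simp] = set_lebesgue_integral_eq_integral
  have "2 * c * G = integral S (\<lambda>t. 2 * c * g t)" by (simp add: G_def)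
  also have "\<dots> \<le> integral S (\<lambda>t. (g t)\<^sup>2 * p t + c\<^sup>2 * (1 / p t))"
  proof (rule integral_le)
    fix t assume t: "t \<in> S"
    have "0 \<le> p t * (g t - c / p t)\<^sup>2" using p(1)[OF t] by simp
    also have "\<dots> = (g t)\<^sup>2 * p t + c\<^sup>2 * (1 / p t) - 2 * c * g t"
      using p(1)[OF t] by (simp add: power2_eq_square field_simps)
    finally show "2 * c * g t \<le> (g t)\<^sup>2 * p t + c\<^sup>2 * (1 / p t)" by simp
  next
    show "(\<lambda>t. 2 * c * g t) integrable_on S"
      using set_integrable_mult_right[OF g, of "2 * c"] by simp
    show "(\<lambda>t. (g t)\<^sup>2 * p t + c\<^sup>2 * (1 / p t)) integrable_on S"
      using set_integral_add(1)[OF gp set_integrable_mult_right[OF p(2), of "c\<^sup>2"]] by simp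
  qed
  also have "\<dots> = A + c\<^sup>2 * integral S (\<lambda>t. 1 / p t)"
    unfolding A_def using gp p(2) set_integrable_mult_right[OF p(2), of "c\<^sup>2"]
    by (subst Henstock_Kurzweil_Integration.integral_add) (auto simp del: times_divide_eq_right)
  also have "\<dots> \<le> A + c\<^sup>2 * D" using D(1) by (intro add_left_mono mult_left_mono) auto
  finally have "G\<^sup>2 / D \<le> A" using D(2) by (simp add: c_def power2_eq_square field_simps)
  thus ?thesis using D(2) unfolding G_def A_def by (simp add: field_simps)
qed

section \<open>The substitution y = (\<beta>+1) x^\<gamma>\<close>

context
  fixes \<theta> \<beta> \<gamma> :: real
  assumes params: "\<theta> > -1" "\<beta> > -1" "\<gamma> > 0"
begin

lemma lag_map_pos: "x > 0 \<Longrightarrow> lag_map \<beta> \<gamma> x > 0"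
  and lag_map_deriv_pos: "x > 0 \<Longrightarrow> lag_map_deriv \<beta> \<gamma> x > 0"
  using params by (auto simp: lag_map_def lag_map_deriv_def)

lemma lag_map_has_derivative:
  "x > 0 \<Longrightarrow> (lag_map \<beta> \<gamma> has_real_derivative lag_map_deriv \<beta> \<gamma> x) (at x)"
  unfolding lag_map_def lag_map_deriv_def
  by (auto intro!: derivative_eq_intros)

lemma lag_map_mono: "0 \<le> x \<Longrightarrow> x \<le> y \<Longrightarrow> lag_map \<beta> \<gamma> x \<le> lag_map \<beta> \<gamma> y"
  using params unfolding lag_map_def by (intro mult_left_mono powr_mono2) auto

lemma inj_on_lag_map: "inj_on (lag_map \<beta> \<gamma>) half_line"
  using params
  by (intro inj_on_inverseI[where g = "\<lambda>y. (y / (\<beta> + 1)) powr (1 / \<gamma>)"]) (auto simp: lag_map_def powr_powr)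

lemma lag_map_image: "lag_map \<beta> \<gamma> ` half_line = half_line"
proof safe
  fix y :: real assume "y > 0"
  thus "y \<in> lag_map \<beta> \<gamma> ` half_line"
    using params by (intro image_eqI[of _ _ "(y / (\<beta> + 1)) powr (1 / \<gamma>)"]) (auto simp: lag_map_def powr_powr)
qed (use lag_map_pos in auto)

lemma continuous_on_lag_map: "A \<subseteq> half_line \<Longrightarrow> continuous_on A (lag_map \<beta> \<gamma>)"
  and continuous_on_lag_map_deriv: "A \<subseteq> half_line \<Longrightarrow> continuous_on A (lag_map_deriv \<beta> \<gamma>)"
  unfolding lag_map_def[abs_def] lag_map_deriv_def[abs_def] by (auto intro!: continuous_intros)

text \<open>The weight is the pullback of y^{\<theta>'} e^{-y} dy. The exponent is kept apart from
  the fixed \<theta> because the derivative is measured with \<theta> + 1.\<close>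

lemma weight_conv_lag_map:
  assumes "x > 0"
  shows "weight \<theta>' \<beta> \<gamma> x = lag_map \<beta> \<gamma> x powr \<theta>' * exp (- lag_map \<beta> \<gamma> x) * lag_map_deriv \<beta> \<gamma> x"
proof -
  have "\<gamma> * (\<theta>' + 1) - 1 = \<gamma> * \<theta>' + (\<gamma> - 1)" by (simp add: algebra_simps)
  hence "x powr (\<gamma> * (\<theta>' + 1) - 1) = (x powr \<gamma>) powr \<theta>' * x powr (\<gamma> - 1)"
    by (simp only: powr_add powr_powr)
  moreover have "(\<beta> + 1) powr (\<theta>' + 1) = (\<beta> + 1) powr \<theta>' * (\<beta> + 1)"
    using params by (simp add: powr_add)
  moreover have "- (\<beta> + 1) * x powr \<gamma> = - lag_map \<beta> \<gamma> x"
    by (simp add: lag_map_def algebra_simps)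
  moreover have "lag_map \<beta> \<gamma> x powr \<theta>' = (\<beta> + 1) powr \<theta>' * (x powr \<gamma>) powr \<theta>'"
    using params by (simp add: lag_map_def powr_mult)
  ultimately show ?thesis
    by (simp only: weight_def lag_map_deriv_def mult_ac)
qed

text \<open>By the chain rule the mapped derivative is d/dy for the new variable y.\<close>

lemma mapped_deriv_conv:
  assumes "x > 0"
  shows "mapped_deriv \<beta> \<gamma> v x = weak_deriv v x / lag_map_deriv \<beta> \<gamma> x"
proof -
  have "x powr (1 - \<gamma>) = 1 / x powr (\<gamma> - 1)"
    using powr_minus_divide[of x "\<gamma> - 1"] by simp
  thus ?thesis by (simp add: mapped_deriv_def lag_map_deriv_def)
qed

lemma L2_norm_squared:
  assumes "v \<in> L2 (weight \<theta>' \<beta> \<gamma>)"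
  shows "(\<lambda>x. (v x)\<^sup>2 * weight \<theta>' \<beta> \<gamma> x) absolutely_integrable_on half_line"
    and "(L2_norm (weight \<theta>' \<beta> \<gamma>) v)\<^sup>2 = integral half_line (\<lambda>x. (v x)\<^sup>2 * weight \<theta>' \<beta> \<gamma> x)"
proof -
  show int: "(\<lambda>x. (v x)\<^sup>2 * weight \<theta>' \<beta> \<gamma> x) absolutely_integrable_on half_line"
    using assms by (simp add: L2_def)
  have "0 \<le> integral half_line (\<lambda>x. (v x)\<^sup>2 * weight \<theta>' \<beta> \<gamma> x)"
    by (rule Henstock_Kurzweil_Integration.integral_nonneg)
      (use int params in \<open>auto simp: set_lebesgue_integral_eq_integral weight_def\<close>)
  thus "(L2_norm (weight \<theta>' \<beta> \<gamma>) v)\<^sup>2 = integral half_line (\<lambda>x. (v x)\<^sup>2 * weight \<theta>' \<beta> \<gamma> x)"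
    using int by (simp add: L2_norm_def set_lebesgue_integral_eq_integral)
qed

lemma L2_norm_squared_restrict:
  assumes "v \<in> L2 (weight \<theta>' \<beta> \<gamma>)" "0 < a"
  shows "(\<lambda>x. (v x)\<^sup>2 * weight \<theta>' \<beta> \<gamma> x) absolutely_integrable_on {a..b}"
    and "integral {a..b} (\<lambda>x. (v x)\<^sup>2 * weight \<theta>' \<beta> \<gamma> x) \<le> (L2_norm (weight \<theta>' \<beta> \<gamma>) v)\<^sup>2"
proof -
  note int = L2_norm_squared(1)[OF assms(1)]
  show sub: "(\<lambda>x. (v x)\<^sup>2 * weight \<theta>' \<beta> \<gamma> x) absolutely_integrable_on {a..b}"
    by (rule set_integrable_subset[OF int]) (use assms(2) in auto)
  show "integral {a..b} (\<lambda>x. (v x)\<^sup>2 * weight \<theta>' \<beta> \<gamma> x) \<le> (L2_norm (weight \<theta>' \<beta> \<gamma>) v)\<^sup>2"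
    unfolding L2_norm_squared(2)[OF assms(1)]
    by (rule integral_subset_le)
      (use int sub assms(2) params in \<open>auto simp: set_lebesgue_integral_eq_integral weight_def\<close>)
qed

lemma continuous_on_weight: "A \<subseteq> half_line \<Longrightarrow> continuous_on A (weight \<theta>' \<beta> \<gamma>)"
  unfolding weight_def[abs_def] by (auto intro!: continuous_intros)

section \<open>The pointwise bound by the A^1-norm\<close>

text \<open>In the mapped variable the interval is [Y/2, Y], of length Y/2. There e^{-y} is at least
  e^{-Y}, and y^\<theta> is at least 2^{-\<theta>} Y^\<theta> or Y^\<theta> according to the sign of
  \<theta>; hence the minimum.\<close>

lemma weight_mass_lower_bound:
  assumes "0 < z" "z < x" "lag_map \<beta> \<gamma> z = lag_map \<beta> \<gamma> x / 2"
  shows "min 1 (2 powr - \<theta>) / 2 * (lag_map \<beta> \<gamma> x powr (\<theta> + 1) * exp (- lag_map \<beta> \<gamma> x))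
    \<le> integral {z..x} (weight \<theta> \<beta> \<gamma>)"
proof -
  define Y where "Y = lag_map \<beta> \<gamma>"
  define k where "k = min 1 (2 powr - \<theta>)"
  have sub: "{z..x} \<subseteq> half_line" using assms(1) by auto
  have Yx: "Y x > 0" using lag_map_pos[of x] assms by (simp add: Y_def)
  have "(lag_map_deriv \<beta> \<gamma> has_integral (Y x - Y z)) {z..x}"
    unfolding Y_def
    by (rule fundamental_theorem_of_calculus)
      (use assms lag_map_has_derivative in
        \<open>auto simp: has_real_derivative_iff_has_vector_derivative[symmetric] intro: has_field_derivative_at_within\<close>)
  from has_integral_mult_right[OF this, of "k * Y x powr \<theta> * exp (- Y x)"]
  have 1: "((\<lambda>t. k * Y x powr \<theta> * exp (- Y x) * lag_map_deriv \<beta> \<gamma> t) has_integral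
      k * Y x powr \<theta> * exp (- Y x) * (Y x - Y z)) {z..x}" .
  have 2: "(weight \<theta> \<beta> \<gamma> has_integral integral {z..x} (weight \<theta> \<beta> \<gamma>)) {z..x}"
    by (intro integrable_integral integrable_continuous_real continuous_on_weight sub)
  have "k * Y x powr \<theta> * exp (- Y x) * (Y x - Y z) \<le> integral {z..x} (weight \<theta> \<beta> \<gamma>)"
  proof (rule has_integral_le[OF 1 2])
    fix t assume t: "t \<in> {z..x}"
    have Yt: "Y x / 2 \<le> Y t" "Y t \<le> Y x"
      using lag_map_mono[of z t] lag_map_mono[of t x] t assms by (auto simp: Y_def)
    have "k * Y x powr \<theta> \<le> Y t powr \<theta>"
    proof (cases "\<theta> \<ge> 0")
      case True
      have "k * Y x powr \<theta> \<le> 2 powr - \<theta> * Y x powr \<theta>"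
        by (intro mult_right_mono) (auto simp: k_def)
      also have "\<dots> = (Y x / 2) powr \<theta>"
        using Yx by (simp add: powr_divide powr_minus_divide)
      also have "\<dots> \<le> Y t powr \<theta>" by (rule powr_mono2) (use Yt Yx True in auto)
      finally show ?thesis .
    next
      case False
      have "k * Y x powr \<theta> \<le> 1 * Y x powr \<theta>"
        by (intro mult_right_mono) (auto simp: k_def)
      also have "\<dots> \<le> Y t powr \<theta>" using Yt Yx False by (simp add: powr_mono2')
      finally show ?thesis .
    qed
    hence "k * Y x powr \<theta> * exp (- Y x) \<le> Y t powr \<theta> * exp (- Y t)"
      using Yt by (intro mult_mono) auto
    hence "k * Y x powr \<theta> * exp (- Y x) * lag_map_deriv \<beta> \<gamma> t \<le> Y t powr \<theta> * exp (- Y t) * lag_map_deriv \<beta> \<gamma> t"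
      using lag_map_deriv_pos[of t] t assms by (intro mult_right_mono) auto
    thus "k * Y x powr \<theta> * exp (- Y x) * lag_map_deriv \<beta> \<gamma> t \<le> weight \<theta> \<beta> \<gamma> t"
      using weight_conv_lag_map[of t \<theta>] t assms by (simp add: Y_def)
  qed
  moreover have "k * Y x powr \<theta> * exp (- Y x) * (Y x - Y z) = k / 2 * (Y x powr (\<theta> + 1) * exp (- Y x))"
  proof -
    have "Y x - Y z = Y x / 2" using assms(3) by (simp add: Y_def)
    moreover have "Y x powr (\<theta> + 1) = Y x powr \<theta> * Y x" using Yx by (simp add: powr_add)
    ultimately show ?thesis by simp
  qed
  ultimately show ?thesis unfolding Y_def k_def by simp
qed

text \<open>The exponential growth towards the right end point makes up for the length of the interval, so
  \<open>z\<close> may be as far away as the point of half the mapped abscissa.\<close>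
lemma weak_increment_bound:
  assumes "0 < z" "z < x" "lag_map \<beta> \<gamma> z \<ge> lag_map \<beta> \<gamma> x / 2"
    and g: "weak_deriv v absolutely_integrable_on {z..x}"
    and D: "mapped_deriv \<beta> \<gamma> v \<in> L2 (weight (\<theta> + 1) \<beta> \<gamma>)"
  shows "(integral {z..x} (weak_deriv v))\<^sup>2 \<le> (L2_norm (weight (\<theta> + 1) \<beta> \<gamma>) (mapped_deriv \<beta> \<gamma> v))\<^sup>2 *
    (2 powr (\<theta> + 1) * (lag_map \<beta> \<gamma> x powr - (\<theta> + 1) * exp (lag_map \<beta> \<gamma> x)))"
proof -
  define Y Y' where "Y = lag_map \<beta> \<gamma>" and "Y' = lag_map_deriv \<beta> \<gamma>"
  define s where "s = \<theta> + 1"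
  have s: "s > 0" using params by (simp add: s_def)
  have sub: "{z..x} \<subseteq> half_line" using assms(1) by auto
  have Yx: "Y x > 0" using lag_map_pos[of x] assms by (simp add: Y_def)
  have pos: "Y t > 0" "Y' t > 0" if "t \<in> {z..x}" for t
    using that assms lag_map_pos[of t] lag_map_deriv_pos[of t] by (auto simp: Y_def Y'_def)
  \<comment> \<open>The weight of the derivative norm, rewritten for \<open>weak_deriv v\<close>. In
    the mapped variable, 1 / p dt becomes y^{-s} e^y dy, whose integral is at most (Y x / 2)^{-s}
    e^{Y x} = \<open>B\<close>.\<close>
  define p where "p t = Y t powr s * exp (- Y t) / Y' t" for t
  define B where "B = 2 powr s * (Y x powr - s * exp (Y x))"
  have p_pos: "p t > 0" if "t \<in> {z..x}" for t
    using pos[OF that] by (simp add: p_def)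
  have eq: "(mapped_deriv \<beta> \<gamma> v t)\<^sup>2 * weight (\<theta> + 1) \<beta> \<gamma> t = (weak_deriv v t)\<^sup>2 * p t" if "t \<in> {z..x}" for t
    using that assms pos[OF that] mapped_deriv_conv[of t v] weight_conv_lag_map[of t "\<theta> + 1"]
    by (simp add: p_def Y_def Y'_def s_def power_divide power2_eq_square)
  have gp: "(\<lambda>t. (weak_deriv v t)\<^sup>2 * p t) absolutely_integrable_on {z..x}"
    using L2_norm_squared_restrict(1)[OF D assms(1), of x]
    by (subst set_integrable_cong[OF refl refl eq[symmetric]])
  have "continuous_on {z..x} Y" "continuous_on {z..x} Y'"
    unfolding Y_def Y'_def using sub by (auto intro: continuous_on_lag_map continuous_on_lag_map_deriv)
  hence cont_p: "continuous_on {z..x} p"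
    unfolding p_def[abs_def] using pos by (intro continuous_intros) (force dest: pos)+
  have inv_p: "(\<lambda>t. 1 / p t) absolutely_integrable_on {z..x}"
    by (intro absolutely_integrable_continuous_real continuous_intros cont_p) (metis p_pos less_irrefl)
  have "((\<lambda>t. exp (Y t)) has_real_derivative exp (Y t) * Y' t) (at t within {z..x})" if "t \<in> {z..x}" for t
    unfolding Y_def Y'_def
    by (rule has_field_derivative_at_within, rule DERIV_fun_exp, rule lag_map_has_derivative)
      (use that assms in auto)
  hence "((\<lambda>t. exp (Y t) * Y' t) has_integral (exp (Y x) - exp (Y z))) {z..x}"
    using assms(2) by (intro fundamental_theorem_of_calculus)
      (simp_all add: has_real_derivative_iff_has_vector_derivative)
  from has_integral_mult_right[OF this, of "(Y x / 2) powr - s"]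
  have 1: "((\<lambda>t. (Y x / 2) powr - s * (exp (Y t) * Y' t)) has_integral
      (Y x / 2) powr - s * (exp (Y x) - exp (Y z))) {z..x}" .
  have "integral {z..x} (\<lambda>t. 1 / p t) \<le> (Y x / 2) powr - s * (exp (Y x) - exp (Y z))"
  proof (rule has_integral_le[OF _ 1])
    show "((\<lambda>t. 1 / p t) has_integral integral {z..x} (\<lambda>t. 1 / p t)) {z..x}"
      using inv_p by (simp add: set_lebesgue_integral_eq_integral integrable_integral)
    fix t assume t: "t \<in> {z..x}"
    have "Y x / 2 \<le> Y t" using lag_map_mono[of z t] t assms by (auto simp: Y_def)
    hence "Y t powr - s \<le> (Y x / 2) powr - s" using Yx s by (intro powr_mono2') auto
    hence "Y t powr - s * (exp (Y t) * Y' t) \<le> (Y x / 2) powr - s * (exp (Y t) * Y' t)"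
      using pos[OF t] by (intro mult_right_mono) auto
    moreover have "1 / p t = Y t powr - s * (exp (Y t) * Y' t)"
      using pos[OF t] by (simp add: p_def powr_minus exp_minus field_simps)
    ultimately show "1 / p t \<le> (Y x / 2) powr - s * (exp (Y t) * Y' t)" by simp
  qed
  also have "\<dots> \<le> (Y x / 2) powr - s * exp (Y x)" by (intro mult_left_mono) auto
  also have "(Y x / 2) powr - s * exp (Y x) = B"
    using Yx by (simp add: B_def powr_divide powr_minus_divide)
  finally have "integral {z..x} (\<lambda>t. 1 / p t) \<le> B" .
  moreover have "B > 0" using Yx by (simp add: B_def)
  ultimately have "(integral {z..x} (weak_deriv v))\<^sup>2 \<le> integral {z..x} (\<lambda>t. (weak_deriv v t)\<^sup>2 * p t) * B"
    using Cauchy_Schwarz_weighted[OF g gp p_pos inv_p] by blast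
  also have "integral {z..x} (\<lambda>t. (weak_deriv v t)\<^sup>2 * p t) =
      integral {z..x} (\<lambda>t. (mapped_deriv \<beta> \<gamma> v t)\<^sup>2 * weight (\<theta> + 1) \<beta> \<gamma> t)"
    by (rule Henstock_Kurzweil_Integration.integral_cong) (simp add: eq)
  also have "\<dots> * B \<le> (L2_norm (weight (\<theta> + 1) \<beta> \<gamma>) (mapped_deriv \<beta> \<gamma> v))\<^sup>2 * B"
    using L2_norm_squared_restrict(2)[OF D assms(1), of x] \<open>B > 0\<close> by (intro mult_right_mono) auto
  finally show ?thesis by (simp add: B_def Y_def s_def)
qed

text \<open>Average (v x)^2 \<le> 2 (v t)^2 + 2 (v x - v t)^2 over t in [z, x] against the weight.
  The norm of v controls the first term and \<open>weak_increment_bound\<close> the second; dividing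
  by the mass, at least k / (2 Q), produces the constant 4 / k.\<close>

lemma A1_pointwise_bound:
  assumes "continuous_on half_line v" "v \<in> A1 \<theta> \<beta> \<gamma>" "x > 0"
  shows "(v x)\<^sup>2 \<le> (4 / min 1 (2 powr - \<theta>) + 2 * 2 powr (\<theta> + 1)) * (A1_norm \<theta> \<beta> \<gamma> v)\<^sup>2 *
    (lag_map \<beta> \<gamma> x powr - (\<theta> + 1) * exp (lag_map \<beta> \<gamma> x))"
proof -
  define Y where "Y = lag_map \<beta> \<gamma>"
  define s k where "s = \<theta> + 1" and "k = min 1 (2 powr - \<theta>)"
  have k: "k > 0" by (simp add: k_def)
  have Yx: "Y x > 0" using lag_map_pos[OF assms(3)] by (simp add: Y_def)
  define Q where "Q = Y x powr - s * exp (Y x)"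
  have Q: "Q > 0" using Yx by (simp add: Q_def)
  have L2: "v \<in> L2 (weight \<theta> \<beta> \<gamma>)" "mapped_deriv \<beta> \<gamma> v \<in> L2 (weight (\<theta> + 1) \<beta> \<gamma>)"
    and weak: "has_weak_deriv v (weak_deriv v)"
    using assms(2) has_weak_deriv_weak_deriv unfolding A1_def by auto
  define N1 N2 where "N1 = (L2_norm (weight \<theta> \<beta> \<gamma>) v)\<^sup>2"
    and "N2 = (L2_norm (weight (\<theta> + 1) \<beta> \<gamma>) (mapped_deriv \<beta> \<gamma> v))\<^sup>2"
  have N: "N1 \<ge> 0" "N2 \<ge> 0" by (auto simp: N1_def N2_def)
  have A1: "(A1_norm \<theta> \<beta> \<gamma> v)\<^sup>2 = N1 + N2" using N by (simp add: A1_norm_def N1_def N2_def)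
  \<comment> \<open>The point whose mapped value is half that of x, the farthest that
    \<open>weak_increment_bound\<close> admits.\<close>
  define z where "z = x * (1 / 2) powr (1 / \<gamma>)"
  have "(1 / 2) powr (1 / \<gamma>) < (1 / 2) powr 0" using params by (intro powr_less_mono') auto
  hence z: "0 < z" "z < x" using assms(3) by (auto simp: z_def)
  have Yz: "Y z = Y x / 2"
    using assms(3) params by (simp add: Y_def lag_map_def z_def powr_mult powr_powr)
  define R where "R = N2 * (2 powr s * Q)"
  have R: "R \<ge> 0" using N Q by (simp add: R_def)
  have step: "(v x)\<^sup>2 \<le> 2 * (v t)\<^sup>2 + 2 * R" if t: "t \<in> {z..x}" for t
  proof (cases "t = x")
    case True
    thus ?thesis using R by simp
  next
    case False
    hence tx: "0 < t" "t < x" using t z by auto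
    note ftc = weak_deriv_fundamental_theorem[OF assms(1) weak tx]
    have "Y x / 2 \<le> Y t" using lag_map_mono[of z t] t z Yz by (simp add: Y_def)
    hence "(v x - v t)\<^sup>2 \<le> R"
      using weak_increment_bound[OF tx _ ftc(1) L2(2)]
      unfolding ftc(2) by (simp add: R_def N2_def Q_def Y_def s_def)
    moreover have "(v x)\<^sup>2 \<le> 2 * (v t)\<^sup>2 + 2 * (v x - v t)\<^sup>2"
      using zero_le_power2[of "v x - 2 * v t"] by (simp add: power2_eq_square algebra_simps)
    ultimately show ?thesis by linarith
  qed
  have sub: "{z..x} \<subseteq> half_line" using z by auto
  define W where "W = integral {z..x} (weight \<theta> \<beta> \<gamma>)"
  have w: "weight \<theta> \<beta> \<gamma> absolutely_integrable_on {z..x}"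
    by (intro absolutely_integrable_continuous_real continuous_on_weight sub)
  have W: "W \<ge> k / 2 / Q"
  proof -
    have "1 / Q = Y x powr s * exp (- Y x)"
      using Yx by (simp add: Q_def powr_minus exp_minus field_simps)
    moreover have "k / 2 * (Y x powr s * exp (- Y x)) \<le> W"
      unfolding W_def k_def Y_def s_def
      by (rule weight_mass_lower_bound[OF z]) (use Yz in \<open>simp add: Y_def\<close>)
    moreover have "k / 2 / Q = k / 2 * (1 / Q)" by simp
    ultimately show ?thesis by (simp only:)
  qed
  moreover have "k / 2 / Q > 0" using k Q by simp
  ultimately have W_pos: "W > 0" by linarith
  have "(v x)\<^sup>2 * W = integral {z..x} (\<lambda>t. (v x)\<^sup>2 * weight \<theta> \<beta> \<gamma> t)"
    by (simp add: W_def)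
  also have "\<dots> \<le> integral {z..x} (\<lambda>t. 2 * ((v t)\<^sup>2 * weight \<theta> \<beta> \<gamma> t) + 2 * R * weight \<theta> \<beta> \<gamma> t)"
  proof (rule integral_le)
    note int = L2_norm_squared_restrict(1)[OF L2(1) z(1), of x]
    show "(\<lambda>t. (v x)\<^sup>2 * weight \<theta> \<beta> \<gamma> t) integrable_on {z..x}"
      using set_integrable_mult_right[OF w, of "(v x)\<^sup>2"] by (simp add: set_lebesgue_integral_eq_integral)
    show "(\<lambda>t. 2 * ((v t)\<^sup>2 * weight \<theta> \<beta> \<gamma> t) + 2 * R * weight \<theta> \<beta> \<gamma> t) integrable_on {z..x}"
      using set_integrable_mult_right[OF w, of "2 * R"] set_integrable_mult_right[OF int, of 2]
      by (intro integrable_add) (simp_all add: set_lebesgue_integral_eq_integral)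
    fix t assume t: "t \<in> {z..x}"
    have "(v x)\<^sup>2 * weight \<theta> \<beta> \<gamma> t \<le> (2 * (v t)\<^sup>2 + 2 * R) * weight \<theta> \<beta> \<gamma> t"
      using step[OF t] params by (intro mult_right_mono) (auto simp: weight_def)
    thus "(v x)\<^sup>2 * weight \<theta> \<beta> \<gamma> t \<le> 2 * ((v t)\<^sup>2 * weight \<theta> \<beta> \<gamma> t) + 2 * R * weight \<theta> \<beta> \<gamma> t"
      by (simp add: algebra_simps)
  qed
  also have "\<dots> = 2 * integral {z..x} (\<lambda>t. (v t)\<^sup>2 * weight \<theta> \<beta> \<gamma> t) + 2 * R * W"
  proof -
    note int = L2_norm_squared_restrict(1)[OF L2(1) z(1), of x]
    show ?thesis
      using set_integrable_mult_right[OF w, of "2 * R"] set_integrable_mult_right[OF int, of 2]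
      unfolding W_def
      by (subst Henstock_Kurzweil_Integration.integral_add) (auto simp: set_lebesgue_integral_eq_integral)
  qed
  also have "\<dots> \<le> 2 * N1 + 2 * R * W"
    using L2_norm_squared_restrict(2)[OF L2(1) z(1), of x] by (simp add: N1_def)
  finally have "(v x)\<^sup>2 \<le> 2 * N1 / W + 2 * R" using W_pos by (simp add: field_simps)
  also have "2 * N1 / W \<le> 2 * N1 / (k / 2 / Q)"
    using W W_pos N k Q by (intro divide_left_mono) auto
  also have "2 * N1 / (k / 2 / Q) = 4 / k * N1 * Q" by simp
  also have "4 / k * N1 * Q + 2 * R = (4 / k * N1 + 2 * 2 powr s * N2) * Q"
    by (simp add: R_def algebra_simps)
  also have "\<dots> \<le> (4 / k + 2 * 2 powr s) * (N1 + N2) * Q"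
  proof (rule mult_right_mono)
    have expand: "(d + c) * (N1 + N2) = (d * N1 + c * N2) + (d * N2 + c * N1)" for c d
      by (simp add: algebra_simps)
    have "0 \<le> 4 / k * N2 + 2 * 2 powr s * N1" using k N by simp
    thus "4 / k * N1 + 2 * 2 powr s * N2 \<le> (4 / k + 2 * 2 powr s) * (N1 + N2)"
      unfolding expand by linarith
  qed (use Q in simp)
  finally show ?thesis unfolding A1 by (simp add: k_def s_def Q_def Y_def)
qed

section \<open>The interpolant in the mapped variable\<close>

definition lag_map_inv :: "real \<Rightarrow> real" where
  "lag_map_inv a = (a / (\<beta> + 1)) powr (1 / \<gamma>)"

lemma lag_map_inv: "a > 0 \<Longrightarrow> lag_map_inv a > 0" "a > 0 \<Longrightarrow> lag_map \<beta> \<gamma> (lag_map_inv a) = a"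
  using params by (auto simp: lag_map_inv_def lag_map_def powr_powr)

definition interpolating_poly :: "nat \<Rightarrow> (real \<Rightarrow> real) \<Rightarrow> real poly" where
  "interpolating_poly n v =
    (\<Sum>a\<in>laguerre_roots \<theta> n. smult (v (lag_map_inv a)) (lagrange (laguerre_roots \<theta> n) a))"

text \<open>The enumeration of the zeros is a bijection onto
  \<open>laguerre_roots \<theta> (M + 1)\<close>, which turns indexed products into products over
  that set; the factors \<beta> + 1 cancel in each quotient.\<close>

lemma interpolant_eq_poly:
  "interpolant \<theta> \<beta> \<gamma> M v x = poly (interpolating_poly (M + 1) v) (lag_map \<beta> \<gamma> x)"
proof -
  define Z where "Z = laguerre_roots \<theta> (M + 1)"
  have Z: "finite Z" "card Z = M + 1" using laguerre_roots[OF params(1)] by (auto simp: Z_def)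
  define y where "y = laguerre_zero \<theta> M"
  have y: "y = (!) (sorted_list_of_set Z)"
    by (simp add: y_def laguerre_zero_def Z_def laguerre_roots_def fun_eq_iff)
  have bij: "bij_betw y {..M} Z"
    unfolding y by (rule bij_betw_nth) (use Z in \<open>auto simp: lessThan_Suc_atMost\<close>)
  have pos: "y i > 0" if "i \<le> M" for i
    using bij_betwE[OF bij] that by (auto simp: Z_def laguerre_roots_def)
  have node: "node \<theta> \<beta> \<gamma> M i = lag_map_inv (y i)" for i
    by (simp add: node_def lag_map_inv_def y_def)
  have node_powr: "node \<theta> \<beta> \<gamma> M i powr \<gamma> = y i / (\<beta> + 1)" if "i \<le> M" for i
    using params pos[OF that] by (simp add: node_def y_def[symmetric] powr_powr)
  have quot: "(x powr \<gamma> - a / (\<beta> + 1)) / (b / (\<beta> + 1) - a / (\<beta> + 1)) = (lag_map \<beta> \<gamma> x - a) / (b - a)" for a b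
  proof -
    have "(x powr \<gamma> - a / (\<beta> + 1)) / (b / (\<beta> + 1) - a / (\<beta> + 1)) =
        ((lag_map \<beta> \<gamma> x - a) / (\<beta> + 1)) / ((b - a) / (\<beta> + 1))"
      using params by (simp add: lag_map_def diff_divide_distrib)
    thus ?thesis using params by simp
  qed
  have "interpolant \<theta> \<beta> \<gamma> M v x =
      (\<Sum>i\<le>M. v (lag_map_inv (y i)) * poly (lagrange Z (y i)) (lag_map \<beta> \<gamma> x))"
    unfolding interpolant_def
  proof (intro sum.cong refl)
    fix i assume i: "i \<in> {..M}"
    have "bij_betw y ({..M} - {i}) (Z - {y i})"
      using bij_betw_DiffI[OF bij, of "{i}" "{y i}"] i bij_betwE[OF bij] by (simp add: bij_betw_def)
    hence "poly (lagrange Z (y i)) (lag_map \<beta> \<gamma> x) =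
        (\<Prod>r\<in>{..M} - {i}. (lag_map \<beta> \<gamma> x - y r) / (y i - y r))"
      unfolding poly_lagrange by (rule prod.reindex_bij_betw[symmetric])
    also have "\<dots> = (\<Prod>r\<in>{..M} - {i}. (x powr \<gamma> - node \<theta> \<beta> \<gamma> M r powr \<gamma>) /
        (node \<theta> \<beta> \<gamma> M i powr \<gamma> - node \<theta> \<beta> \<gamma> M r powr \<gamma>))"
      using i by (intro prod.cong refl) (simp add: node_powr quot)
    finally show "v (node \<theta> \<beta> \<gamma> M i) * (\<Prod>r\<in>{..M} - {i}. (x powr \<gamma> - node \<theta> \<beta> \<gamma> M r powr \<gamma>) /
        (node \<theta> \<beta> \<gamma> M i powr \<gamma> - node \<theta> \<beta> \<gamma> M r powr \<gamma>)) =
      v (lag_map_inv (y i)) * poly (lagrange Z (y i)) (lag_map \<beta> \<gamma> x)"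
      by (simp add: node)
  qed
  also have "\<dots> = (\<Sum>a\<in>Z. v (lag_map_inv a) * poly (lagrange Z a) (lag_map \<beta> \<gamma> x))"
    by (rule sum.reindex_bij_betw[OF bij])
  finally show ?thesis by (simp add: interpolating_poly_def Z_def poly_sum)
qed

text \<open>After the substitution the integrand is a polynomial of degree at most 2 M < 2 (M + 1)
  against the Laguerre weight, so the quadrature is exact.\<close>

lemma L2_norm_interpolant:
  "(L2_norm (weight \<theta> \<beta> \<gamma>) (interpolant \<theta> \<beta> \<gamma> M v))\<^sup>2 =
    (\<Sum>a\<in>laguerre_roots \<theta> (M + 1). gauss_weight \<theta> (M + 1) a * (v (lag_map_inv a))\<^sup>2)"
proof -
  define Z where "Z = laguerre_roots \<theta> (M + 1)"
  have Z: "finite Z" "card Z = M + 1" using laguerre_roots[OF params(1)] by (auto simp: Z_def)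
  define q where "q = interpolating_poly (M + 1) v"
  let ?F = "\<lambda>y. poly (q\<^sup>2) y * (y powr \<theta> * exp (- y))"
  let ?I = "\<lambda>x. (interpolant \<theta> \<beta> \<gamma> M v x)\<^sup>2 * weight \<theta> \<beta> \<gamma> x"
  have "?F absolutely_integrable_on half_line"
    using lag_integrable_poly(1)[OF params(1)] by (simp only: lag_integrable_def)
  hence "(\<lambda>x. \<bar>lag_map_deriv \<beta> \<gamma> x\<bar> * ?F (lag_map \<beta> \<gamma> x)) absolutely_integrable_on half_line \<and>
      integral half_line (\<lambda>x. \<bar>lag_map_deriv \<beta> \<gamma> x\<bar> * ?F (lag_map \<beta> \<gamma> x)) = lag_integral \<theta> (poly (q\<^sup>2))"
    by (subst has_absolute_integral_change_of_variables_1'[where g = "lag_map \<beta> \<gamma>"])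
      (use inj_on_lag_map in \<open>auto simp: lag_map_image lag_integral_def
        intro: has_field_derivative_at_within[OF lag_map_has_derivative]\<close>)
  moreover have "\<bar>lag_map_deriv \<beta> \<gamma> x\<bar> * ?F (lag_map \<beta> \<gamma> x) = ?I x" if "x > 0" for x
    using weight_conv_lag_map[OF that, of \<theta>] lag_map_deriv_pos[OF that]
    by (simp add: interpolant_eq_poly q_def)
  note half_line_cong[OF this]
  ultimately have int: "?I absolutely_integrable_on half_line"
    and val: "integral half_line ?I = lag_integral \<theta> (poly (q\<^sup>2))" by auto
  have "0 \<le> integral half_line ?I"
    by (rule Henstock_Kurzweil_Integration.integral_nonneg)
      (use int params in \<open>auto simp: set_lebesgue_integral_eq_integral weight_def\<close>)
  hence "(L2_norm (weight \<theta> \<beta> \<gamma>) (interpolant \<theta> \<beta> \<gamma> M v))\<^sup>2 = lag_integral \<theta> (poly (q\<^sup>2))"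
    using int val by (simp add: L2_norm_def set_lebesgue_integral_eq_integral)
  also have "\<dots> = (\<Sum>a\<in>Z. gauss_weight \<theta> (M + 1) a * poly (q\<^sup>2) a)"
    unfolding Z_def
  proof (rule gauss_quadrature[OF params(1)])
    have "degree q \<le> M"
      unfolding q_def interpolating_poly_def Z_def[symmetric] using degree_lagrange_le[OF Z(1)] Z(2)
      by (intro degree_sum_le Z) (auto intro: degree_smult_le[THEN order_trans])
    thus "degree (q\<^sup>2) < 2 * (M + 1)"
      using degree_power_le[of q 2] by simp
  qed
  also have "\<dots> = (\<Sum>a\<in>Z. gauss_weight \<theta> (M + 1) a * (v (lag_map_inv a))\<^sup>2)"
  proof (intro sum.cong refl)
    fix b assume b: "b \<in> Z"
    have "poly q b = v (lag_map_inv b)"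
      unfolding q_def interpolating_poly_def Z_def[symmetric] using b Z
      by (simp add: poly_sum poly_lagrange_node if_distrib cong: if_cong)
    thus "gauss_weight \<theta> (M + 1) b * poly (q\<^sup>2) b = gauss_weight \<theta> (M + 1) b * (v (lag_map_inv b))\<^sup>2"
      by simp
  qed
  finally show ?thesis by (simp add: Z_def)
qed

lemma interpolant_log_bound:
  "\<exists>C>0. \<forall>M::nat. M \<ge> 2 \<longrightarrow> (\<forall>v. continuous_on half_line v \<and> v \<in> A1 \<theta> \<beta> \<gamma> \<longrightarrow>
    L2_norm (weight \<theta> \<beta> \<gamma>) (interpolant \<theta> \<beta> \<gamma> M v) \<le> C * (sqrt (ln (real M)) * A1_norm \<theta> \<beta> \<gamma> v))"
proof -
  obtain C where C: "C > 0" "\<And>M. M \<ge> 2 \<Longrightarrow> (\<Sum>a\<in>laguerre_roots \<theta> (M + 1).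
      gauss_weight \<theta> (M + 1) a * (a powr - (\<theta> + 1) * exp a)) \<le> C * ln (real M)"
    using gauss_sum_log_bound[OF params(1)] by blast
  define K where "K = 4 / min 1 (2 powr - \<theta>) + 2 * 2 powr (\<theta> + 1)"
  have K: "K > 0" unfolding K_def by (intro add_pos_pos divide_pos_pos) auto
  have "L2_norm (weight \<theta> \<beta> \<gamma>) (interpolant \<theta> \<beta> \<gamma> M v) \<le> sqrt (K * C) * (sqrt (ln (real M)) * A1_norm \<theta> \<beta> \<gamma> v)"
    if M: "M \<ge> 2" and v: "continuous_on half_line v" "v \<in> A1 \<theta> \<beta> \<gamma>" for M v
  proof (rule power2_le_imp_le)
    define Z where "Z = laguerre_roots \<theta> (M + 1)"
    let ?N = "A1_norm \<theta> \<beta> \<gamma> v"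
    have "(L2_norm (weight \<theta> \<beta> \<gamma>) (interpolant \<theta> \<beta> \<gamma> M v))\<^sup>2 =
        (\<Sum>a\<in>Z. gauss_weight \<theta> (M + 1) a * (v (lag_map_inv a))\<^sup>2)"
      unfolding Z_def by (rule L2_norm_interpolant)
    also have "\<dots> \<le> (\<Sum>a\<in>Z. gauss_weight \<theta> (M + 1) a * (K * ?N\<^sup>2 * (a powr - (\<theta> + 1) * exp a)))"
    proof (intro sum_mono mult_left_mono)
      fix a assume a: "a \<in> Z"
      hence "a > 0" by (simp add: Z_def laguerre_root_pos)
      thus "(v (lag_map_inv a))\<^sup>2 \<le> K * ?N\<^sup>2 * (a powr - (\<theta> + 1) * exp a)"
        using A1_pointwise_bound[OF v lag_map_inv(1)] by (simp add: lag_map_inv(2) K_def)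
      show "gauss_weight \<theta> (M + 1) a \<ge> 0"
        using gauss_weight_pos[OF params(1)] a by (simp add: Z_def less_imp_le)
    qed
    also have "\<dots> = K * ?N\<^sup>2 * (\<Sum>a\<in>Z. gauss_weight \<theta> (M + 1) a * (a powr - (\<theta> + 1) * exp a))"
      by (simp add: sum_distrib_left mult_ac)
    also have "\<dots> \<le> K * ?N\<^sup>2 * (C * ln (real M))"
      unfolding Z_def using C(2)[OF M] K by (intro mult_left_mono) auto
    also have "\<dots> = (sqrt (K * C) * (sqrt (ln (real M)) * ?N))\<^sup>2"
      using K C(1) M by (simp add: power_mult_distrib)
    finally show "(L2_norm (weight \<theta> \<beta> \<gamma>) (interpolant \<theta> \<beta> \<gamma> M v))\<^sup>2 \<le>
      (sqrt (K * C) * (sqrt (ln (real M)) * ?N))\<^sup>2" .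
    show "0 \<le> sqrt (K * C) * (sqrt (ln (real M)) * ?N)"
      using K C(1) M by (auto simp: A1_norm_def intro!: mult_nonneg_nonneg)
  qed
  moreover have "sqrt (K * C) > 0" using K C(1) by simp
  ultimately show ?thesis by blast
qed

end

text \<open>The case M = 1 has to be excluded: there the logarithm is 0, and a constant nonzero v
  would make the right-hand side vanish but not the left.\<close>

theorem theorem2p2:
  fixes \<theta> \<beta> \<gamma> :: real
  assumes "\<theta> > -1" and "\<beta> > -1" and "0 < \<gamma>" and "\<gamma> < 1"
  shows "\<exists>C>0. \<forall>M::nat. M \<ge> 2 \<longrightarrow>
    (\<forall>v. continuous_on half_line v \<and> v \<in> A1 \<theta> \<beta> \<gamma> \<and>
         mapped_deriv \<beta> \<gamma> v \<in> L2 (weight \<theta> \<beta> \<gamma>) \<longrightarrow>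
       L2_norm (weight \<theta> \<beta> \<gamma>) (interpolant \<theta> \<beta> \<gamma> M v)
         \<le> C * (real M powr (-1/2) * L2_norm (weight \<theta> \<beta> \<gamma>) (mapped_deriv \<beta> \<gamma> v)
               + 2 * sqrt (ln (real M)) * A1_norm \<theta> \<beta> \<gamma> v))"
proof -
  obtain C where C: "C > 0" "\<And>M v. M \<ge> 2 \<Longrightarrow> continuous_on half_line v \<Longrightarrow> v \<in> A1 \<theta> \<beta> \<gamma> \<Longrightarrow>
      L2_norm (weight \<theta> \<beta> \<gamma>) (interpolant \<theta> \<beta> \<gamma> M v) \<le> C * (sqrt (ln (real M)) * A1_norm \<theta> \<beta> \<gamma> v)"
    using interpolant_log_bound[OF assms(1-3)] by blast
  have "L2_norm (weight \<theta> \<beta> \<gamma>) (interpolant \<theta> \<beta> \<gamma> M v)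
         \<le> C * (real M powr (-1/2) * L2_norm (weight \<theta> \<beta> \<gamma>) (mapped_deriv \<beta> \<gamma> v)
               + 2 * sqrt (ln (real M)) * A1_norm \<theta> \<beta> \<gamma> v)"
    if M: "M \<ge> 2" and v: "continuous_on half_line v" "v \<in> A1 \<theta> \<beta> \<gamma>"
      and D: "mapped_deriv \<beta> \<gamma> v \<in> L2 (weight \<theta> \<beta> \<gamma>)" for M :: nat and v
  \<comment> \<open>Adding the nonnegative derivative term and doubling the logarithmic one only
    enlarges the right-hand side.\<close>
  proof (rule order_trans[OF C(2)[OF M v]], intro mult_left_mono)
    have "0 \<le> (LINT x:half_line|lebesgue. \<bar>mapped_deriv \<beta> \<gamma> v x\<bar>\<^sup>2 * weight \<theta> \<beta> \<gamma> x)"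
      unfolding set_lebesgue_integral_def using assms(2,3)
      by (intro Bochner_Integration.integral_nonneg) (auto simp: weight_def)
    hence "0 \<le> real M powr (-1/2) * L2_norm (weight \<theta> \<beta> \<gamma>) (mapped_deriv \<beta> \<gamma> v)"
      by (simp add: L2_norm_def)
    moreover have "0 \<le> sqrt (ln (real M)) * A1_norm \<theta> \<beta> \<gamma> v"
      using M by (auto simp: A1_norm_def)
    ultimately show "sqrt (ln (real M)) * A1_norm \<theta> \<beta> \<gamma> v \<le>
        real M powr (-1/2) * L2_norm (weight \<theta> \<beta> \<gamma>) (mapped_deriv \<beta> \<gamma> v) +
        2 * sqrt (ln (real M)) * A1_norm \<theta> \<beta> \<gamma> v" by linarith
  qed (use C(1) in simp)
  thus ?thesis using C(1) by blast
qed

end
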